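(* There exist universal positive constants $c_1,c_2,c_3$ such that the following holds. Let $F^*\in\{0,1\}^d$ be the membership vector of a cluster of $k$ vertices (exactly $k$ entries equal to one), let $0\le q<p\le1$, and let $A\in\{0,1\}^{d\times d}$ be the random symmetric adjacency matrix of the planted densest subgraph model with parameters $(d,k,p,q)$. Suppose $$\frac{(p-q)^2}{p}\ge c_1\Big(\frac{\log d}{k}+\frac{d}{k^2}\Big).$$ Let $S=A-\frac{p+q}{2}J_d$, where $J_d$ is the $d\times d$ all-ones matrix, $\tilde{\mathcal L}_n(F)=-\langle\langle S,FF^\top\rangle\rangle$ for $F\in\mathbb R^d$, and $\mathcal F=\{F\in[0,1]^d:\sum_{i=1}^dF_i=k\}$. Then with probability at least $1-d^{-3}$, given an initial vector $F^0\in\mathcal F\cap\mathbb B_2(\tfrac15\sqrt k;F^* )$, the projected gradient iterates $$F^{t+1}=\Pi_{\mathcal F}\big(F^t-\eta^t\nabla\tilde{\mathcal L}_n(F^t)\big),\qquad\eta^t=c_2\frac{1}{(p-q)k},$$ satisfy $$d^2(F^t,F^* )\le(1-c_3)^t\,d^2(F^0,F^* )\qquad\text{for all }t=1,2,\dots.$$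
   Context: Planted densest subgraph model: the entries $A_{ij}$, $i\le j$, are independent, with $A_{ij}=1$ with probability $p$ if both $i$ and $j$ belong to the cluster, $A_{ij}=1$ with probability $q$ for all other pairs, and $A_{ij}=0$ otherwise; $A$ is symmetric. $\langle\langle A,B\rangle\rangle=\operatorname{trace}(A^\top B)$; $\nabla\tilde{\mathcal L}_n(F)=-2SF$; $\Pi_{\mathcal F}$ is Euclidean projection onto $\mathcal F$. $d(F,F^* )=\min\{\|F-F^*\|_2,\|F+F^*\|_2\}$ and $\mathbb B_2(\rho;F^* )=\{F\in\mathbb R^d:d(F,F^* )\le\rho\}$. *)

theory Defs
  imports "HOL-Probability.Product_PMF" "Jordan_Normal_Form.Matrix"
begin

hide_type (open) Finite_Cartesian_Product.vec
hide_const (open) Finite_Cartesian_Product.vec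
no_notation Finite_Cartesian_Product.vec_nth (infixl \<open>$\<close> 90)
no_notation Inner_Product.real_inner_class.inner (infix \<open>\<bullet>\<close> 70)

definition l2norm :: "real vec \<Rightarrow> real" where
  "l2norm x = sqrt (x \<bullet> x)"

definition mat_trace :: "real mat \<Rightarrow> real" where
  "mat_trace B = (\<Sum>i<dim_row B. B $$ (i, i))"

definition frob_inner :: "real mat \<Rightarrow> real mat \<Rightarrow> real" where
  "frob_inner B C = mat_trace (transpose_mat B * C)"

definition outer :: "real vec \<Rightarrow> real mat" where
  "outer x = mat (dim_vec x) (dim_vec x) (\<lambda>(i, j). x $ i * x $ j)"

definition ones_mat :: "nat \<Rightarrow> real mat" where
  "ones_mat d = mat d d (\<lambda>_. 1)"

definition loss :: "real mat \<Rightarrow> real vec \<Rightarrow> real" where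
  "loss S F = - frob_inner S (outer F)"

text \<open>The gradient, as the vector of partial derivatives.  For a symmetric matrix \<open>S\<close> the
  gradient of \<open>loss S\<close> is the familiar \<open>-2 S F\<close>, see \<open>gradient_loss\<close> below.\<close>

definition gradient :: "(real vec \<Rightarrow> real) \<Rightarrow> real vec \<Rightarrow> real vec" where
  "gradient f x = vec (dim_vec x) (\<lambda>i. deriv (\<lambda>s. f (x |\<^sub>v i \<mapsto> s)) (x $ i))"

definition proj :: "real vec set \<Rightarrow> real vec \<Rightarrow> real vec" where
  "proj C x = arg_min (\<lambda>y. l2norm (x - y)) (\<lambda>y. y \<in> C)"

primrec proj_grad_iter ::
  "real vec set \<Rightarrow> (nat \<Rightarrow> real) \<Rightarrow> (real vec \<Rightarrow> real) \<Rightarrow> real vec \<Rightarrow> nat \<Rightarrow> real vec" where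
  "proj_grad_iter C \<eta> f F0 0 = F0"
| "proj_grad_iter C \<eta> f F0 (Suc t) =
     (let F = proj_grad_iter C \<eta> f F0 t in proj C (F - \<eta> t \<cdot>\<^sub>v gradient f F))"

definition sign_dist :: "real vec \<Rightarrow> real vec \<Rightarrow> real" where
  "sign_dist F G = min (l2norm (F - G)) (l2norm (F + G))"

definition sign_ball :: "nat \<Rightarrow> real \<Rightarrow> real vec \<Rightarrow> real vec set" where
  "sign_ball d \<rho> G = {F \<in> carrier_vec d. sign_dist F G \<le> \<rho>}"

definition feasible :: "nat \<Rightarrow> nat \<Rightarrow> real vec set" where
  "feasible d k = {F \<in> carrier_vec d. (\<forall>i<d. 0 \<le> F $ i \<and> F $ i \<le> 1) \<and> (\<Sum>i<d. F $ i) = real k}"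

definition cluster_vectors :: "nat \<Rightarrow> nat \<Rightarrow> real vec set" where
  "cluster_vectors d k =
     {F \<in> carrier_vec d. (\<forall>i<d. F $ i \<in> {0, 1}) \<and> card {i. i < d \<and> F $ i = 1} = k}"

text \<open>The law of the random adjacency matrix: independent Bernoulli entries are drawn for the
  index pairs \<open>i \<le> j\<close> (diagonal included) and reflected across the diagonal.\<close>

definition planted_densest_subgraph :: "nat \<Rightarrow> real vec \<Rightarrow> real \<Rightarrow> real \<Rightarrow> real mat pmf" where
  "planted_densest_subgraph d Fs p q =
     map_pmf (\<lambda>X. mat d d (\<lambda>(i, j). of_bool (X (min i j, max i j))))
       (Pi_pmf {(i, j). i \<le> j \<and> j < d} False
          (\<lambda>(i, j). bernoulli_pmf (if Fs $ i = 1 \<and> Fs $ j = 1 then p else q)))"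

lemma loss_quadratic:
  assumes "S \<in> carrier_mat n n" "F \<in> carrier_vec n"
  shows "loss S F = - (\<Sum>i<n. \<Sum>j<n. S $$ (i, j) * F $ i * F $ j)"
proof -
  have "frob_inner S (outer F) = (\<Sum>i<n. \<Sum>j<n. S $$ (j, i) * (F $ j * F $ i))"
    using assms
    by (auto simp: frob_inner_def mat_trace_def outer_def scalar_prod_def atLeast0LessThan
        intro!: sum.cong)
  also have "\<dots> = (\<Sum>i<n. \<Sum>j<n. S $$ (i, j) * F $ i * F $ j)"
    by (subst sum.swap) (simp add: mult_ac)
  finally show ?thesis by (simp add: loss_def)
qed

lemma gradient_loss:
  assumes S: "S \<in> carrier_mat n n" and sym: "transpose_mat S = S" and F: "F \<in> carrier_vec n"
  shows "gradient (loss S) F = (-2) \<cdot>\<^sub>v (S *\<^sub>v F)"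
proof (rule eq_vecI)
  show "dim_vec (gradient (loss S) F) = dim_vec ((-2) \<cdot>\<^sub>v (S *\<^sub>v F))"
    using S F by (simp add: gradient_def)
  fix l assume "l < dim_vec ((-2) \<cdot>\<^sub>v (S *\<^sub>v F))"
  then have l: "l < n" using S by simp
  have S_sym: "S $$ (i, j) = S $$ (j, i)" if "i < n" "j < n" for i j
    using S that arg_cong[OF sym, of "\<lambda>M. M $$ (i, j)"] by simp
  define g where "g s i = (if i = l then s else F $ i)" for s i
  define e :: "nat \<Rightarrow> real" where "e i = (if i = l then 1 else 0)" for i
  have eq: "loss S (F |\<^sub>v l \<mapsto> s) = - (\<Sum>i<n. \<Sum>j<n. S $$ (i, j) * g s i * g s j)" for s
  proof -
    have "(F |\<^sub>v l \<mapsto> s) $ i = g s i" if "i < n" for i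
      using that F by (simp add: update_vec_def g_def)
    then show ?thesis
      using F by (subst loss_quadratic[OF S]) (auto simp: update_vec_def intro!: sum.cong)
  qed
  have dg: "((\<lambda>s. g s i) has_real_derivative e i) (at s)" for i s
    by (cases "i = l") (auto simp: g_def e_def)
  have g_self: "g (F $ l) i = F $ i" for i
    by (simp add: g_def)
  have "((\<lambda>s. S $$ (i, j) * g s i * g s j) has_real_derivative
      S $$ (i, j) * e i * F $ j + S $$ (i, j) * F $ i * e j) (at (F $ l))" for i j
    using DERIV_cmult[OF DERIV_mult[OF dg[of i "F $ l"] dg[of j "F $ l"]], of "S $$ (i, j)"]
    by (simp add: g_self algebra_simps)
  then have "((\<lambda>s. - (\<Sum>i<n. \<Sum>j<n. S $$ (i, j) * g s i * g s j)) has_real_derivative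
      - (\<Sum>i<n. \<Sum>j<n. S $$ (i, j) * e i * F $ j + S $$ (i, j) * F $ i * e j)) (at (F $ l))"
    by (intro DERIV_minus DERIV_sum)
  also have "(\<Sum>i<n. \<Sum>j<n. S $$ (i, j) * e i * F $ j + S $$ (i, j) * F $ i * e j)
      = (\<Sum>j<n. \<Sum>i<n. S $$ (i, j) * e i * F $ j) + (\<Sum>i<n. \<Sum>j<n. S $$ (i, j) * F $ i * e j)"
    unfolding sum.distrib by (subst sum.swap) (rule refl)
  also have "(\<Sum>j<n. \<Sum>i<n. S $$ (i, j) * e i * F $ j) = (\<Sum>j<n. S $$ (l, j) * F $ j)"
  proof (rule sum.cong[OF refl])
    fix j
    have "(\<Sum>i<n. S $$ (i, j) * e i * F $ j) = (\<Sum>i<n. if i = l then S $$ (l, j) * F $ j else 0)"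
      by (intro sum.cong) (auto simp: e_def)
    then show "(\<Sum>i<n. S $$ (i, j) * e i * F $ j) = S $$ (l, j) * F $ j"
      using l by simp
  qed
  also have "(\<Sum>i<n. \<Sum>j<n. S $$ (i, j) * F $ i * e j) = (\<Sum>i<n. S $$ (l, i) * F $ i)"
  proof (rule sum.cong[OF refl])
    fix i assume "i \<in> {..<n}"
    then have "S $$ (i, l) = S $$ (l, i)"
      using l S_sym by simp
    moreover have "(\<Sum>j<n. S $$ (i, j) * F $ i * e j) = (\<Sum>j<n. if j = l then S $$ (i, l) * F $ i else 0)"
      by (intro sum.cong) (auto simp: e_def)
    ultimately show "(\<Sum>j<n. S $$ (i, j) * F $ i * e j) = S $$ (l, i) * F $ i"
      using l by simp
  qed
  also have "(\<Sum>j<n. S $$ (l, j) * F $ j) + (\<Sum>i<n. S $$ (l, i) * F $ i)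
      = 2 * (\<Sum>j<n. S $$ (l, j) * F $ j)"
    by simp
  finally have "((\<lambda>s. loss S (F |\<^sub>v l \<mapsto> s)) has_real_derivative
      - (2 * (\<Sum>j<n. S $$ (l, j) * F $ j))) (at (F $ l))"
    unfolding eq .
  then have "deriv (\<lambda>s. loss S (F |\<^sub>v l \<mapsto> s)) (F $ l) = - (2 * (\<Sum>j<n. S $$ (l, j) * F $ j))"
    by (rule DERIV_imp_deriv)
  then show "gradient (loss S) F $ l = ((-2) \<cdot>\<^sub>v (S *\<^sub>v F)) $ l"
    using l S F by (simp add: gradient_def scalar_prod_def atLeast0LessThan)
qed

end

theory Submission
  imports Defs
begin

text \<open>
  Put \<open>W = A - E A\<close>, \<open>\<delta> = p - q\<close> and \<open>M = \<delta> k\<close>; up to a multiple of \<open>J\<close>, which is invisible on the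
  hyperplane containing the feasible set, \<open>S\<close> is \<open>W + \<delta> F* F*\<^sup>T\<close>.  Let \<open>u\<close> and \<open>v\<close> be the errors before
  and after a step and let \<open>a\<close>, \<open>b\<close> be half of their 1-norms.  The variational inequality of the projection gives
  \<open>|v|\<^sup>2 \<le> |u|\<^sup>2 + (4/M) (\<langle>W F*, v\<rangle> + \<langle>W u, v\<rangle> - \<delta> (k - a) b)\<close>, where \<open>a \<le> k/5\<close> and \<open>|v|\<^sup>2 \<le> 2 b\<close>.  So it is
  enough that \<open>\<langle>W F*, v\<rangle> \<le> \<epsilon> M b\<close>, a bound on the entries of \<open>W F*\<close>, and that
  \<open>\<langle>W u, v\<rangle> \<le> \<epsilon> M (b + |u|\<^sup>2)\<close>.  Since \<open>v\<close> enters the latter through its 1-norm, \<open>v\<close> can be replaced by the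
  indicator of a set \<open>T\<close>.

  This avoids an operator norm bound, which for such sparse matrices needs more than a net argument.
  For fixed \<open>T\<close> of size \<open>s\<close>, the supremum over \<open>u \<in> [-1,1]\<^sup>d\<close> is a sum of Huber functions of the entries of
  \<open>W 1\<^sub>T\<close>.  The exponential of a Huber function is dominated by \<open>cosh (\<theta> x) ^ n\<close>, an average of the functions
  \<open>exp (\<xi> x)\<close> over a Rademacher sum \<open>\<xi>\<close> bounded by \<open>n \<theta> = 1/2\<close>, so only the moment generating function of
  \<open>\<langle>W 1\<^sub>T, \<xi>\<rangle>\<close> is needed.  The resulting failure probability \<open>exp (-6 s (1 + ln (d/s)))\<close> survives the
  union bound over \<open>T\<close>.
\<close>

subsection \<open>Exponential moments\<close>

text \<open>This is \<open>tanh z \<le> z\<close>, the comparison of derivatives behind the next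
  lemma.\<close>

lemma sinh_le_mult_cosh:
  assumes "0 \<le> (z::real)" shows "sinh z \<le> z * cosh z"
proof -
  have "(\<lambda>x. x * cosh x - sinh x) 0 \<le> (\<lambda>x::real. x * cosh x - sinh x) z"
  proof (rule DERIV_nonneg_imp_nondecreasing[OF assms])
    fix x :: real assume "0 \<le> x" "x \<le> z"
    moreover have "((\<lambda>x. x * cosh x - sinh x) has_real_derivative x * sinh x) (at x)"
      by (auto intro!: derivative_eq_intros)
    ultimately show "\<exists>y. ((\<lambda>x. x * cosh x - sinh x) has_real_derivative y) (at x) \<and> 0 \<le> y"
      by (intro exI[of _ "x * sinh x"]) simp
  qed
  then show ?thesis by simp
qed

text \<open>The sub-Gaussian moment bound for one random sign. The two logarithms agree at 0 and
  have derivatives \<open>tanh x\<close> and \<open>x\<close>; evenness covers negative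
  \<open>z\<close>.\<close>

lemma cosh_le_exp_half_square: "cosh (z::real) \<le> exp (z\<^sup>2 / 2)"
proof -
  have "cosh z \<le> exp (z\<^sup>2 / 2)" if z: "0 \<le> z" for z :: real
  proof -
    have "(\<lambda>x. x\<^sup>2 / 2 - ln (cosh x)) 0 \<le> (\<lambda>x::real. x\<^sup>2 / 2 - ln (cosh x)) z"
    proof (rule DERIV_nonneg_imp_nondecreasing[OF z])
      fix x :: real assume "0 \<le> x" "x \<le> z"
      then have "0 \<le> x - sinh x / cosh x"
        using sinh_le_mult_cosh[of x] by (simp add: pos_divide_le_eq)
      moreover have "((\<lambda>x. x\<^sup>2 / 2 - ln (cosh x)) has_real_derivative x - sinh x / cosh x) (at x)"
        by (auto intro!: derivative_eq_intros)
      ultimately show "\<exists>y. ((\<lambda>x. x\<^sup>2 / 2 - ln (cosh x)) has_real_derivative y) (at x) \<and> 0 \<le> y"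
        by blast
    qed
    then have "ln (cosh z) \<le> z\<^sup>2 / 2" by simp
    then have "exp (ln (cosh z)) \<le> exp (z\<^sup>2 / 2)" by (simp only: exp_le_cancel_iff)
    then show ?thesis by simp
  qed
  from this[of z] this[of "- z"] show ?thesis by (cases "0 \<le> z") auto
qed

text \<open>For negative \<open>x\<close>, multiply by \<open>1 - x\<close>: the left side becomes
  at most 1, the right side \<open>1 - x ^ 3\<close>, at least 1.\<close>

lemma exp_le_quadratic: "exp x \<le> 1 + x + x\<^sup>2" if "\<bar>x\<bar> \<le> 1" for x :: real
proof (cases "0 \<le> x")
  case True
  then show ?thesis using that by (intro exp_bound) auto
next
  case False
  then have "exp x * (1 - x) \<le> exp x * exp (- x)"
    using exp_ge_add_one_self[of "- x"] by (intro mult_left_mono) auto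
  also have "\<dots> = 1" by (simp flip: exp_add)
  also have "1 \<le> 1 - x ^ 3" using False by (simp add: power3_eq_cube mult_nonneg_nonpos2 zero_le_square
        mult_le_0_iff)
  also have "\<dots> = (1 + x + x\<^sup>2) * (1 - x)" by (simp add: power2_eq_square power3_eq_cube algebra_simps)
  finally show ?thesis using False by simp
qed

text \<open>Centring cancels the linear terms and leaves the variance \<open>r * (1 - r)\<close>, at
  most \<open>p\<close>. Keeping \<open>p\<close> in place of a constant is what makes the later
  tails strong enough for sparse graphs.\<close>

lemma bernoulli_mgf_le:
  assumes "0 \<le> r" "r \<le> p" "p \<le> 1" "\<bar>b\<bar> \<le> 1"
  shows "measure_pmf.expectation (bernoulli_pmf r) (\<lambda>v. exp (b * (of_bool v - r))) \<le> exp (p * b\<^sup>2)"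
proof -
  have small: "\<bar>b * (1 - r)\<bar> \<le> 1" "\<bar>- (b * r)\<bar> \<le> 1"
    using assms by (auto simp: abs_mult intro!: mult_le_one)
  have "measure_pmf.expectation (bernoulli_pmf r) (\<lambda>v. exp (b * (of_bool v - r)))
      = r * exp (b * (1 - r)) + (1 - r) * exp (- (b * r))"
    using assms by (simp add: algebra_simps)
  also have "\<dots> \<le> r * (1 + b * (1 - r) + (b * (1 - r))\<^sup>2) + (1 - r) * (1 + - (b * r) + (- (b * r))\<^sup>2)"
    using assms by (intro add_mono mult_left_mono exp_le_quadratic small) auto
  also have "\<dots> = 1 + r * (1 - r) * b\<^sup>2"
    by (simp add: power2_eq_square algebra_simps)
  also have "\<dots> \<le> 1 + p * b\<^sup>2"
    using assms mult_mono[of r p "1 - r" 1] by (auto intro!: mult_right_mono)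
  also have "\<dots> \<le> exp (p * b\<^sup>2)" by (rule exp_ge_add_one_self)
  finally show ?thesis .
qed

text \<open>Pascal's rule under the sum. After division by powers of 2 it splits one sign off a
  Rademacher sum.\<close>

lemma sum_binomial_Suc:
  fixes f :: "nat \<Rightarrow> real"
  shows "(\<Sum>k\<le>Suc n. real (Suc n choose k) * f k) = (\<Sum>k\<le>n. real (n choose k) * (f k + f (Suc k)))"
proof -
  have "(\<Sum>k\<le>Suc n. real (Suc n choose k) * f k) = f 0 + (\<Sum>k\<le>n. real (Suc n choose Suc k) * f (Suc k))"
    by (subst sum.atMost_Suc_shift) simp
  also have "\<dots> = (f 0 + (\<Sum>k\<le>n. real (n choose Suc k) * f (Suc k))) + (\<Sum>k\<le>n. real (n choose k) * f (Suc k))"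
    by (simp add: sum.distrib algebra_simps)
  also have "f 0 + (\<Sum>k\<le>n. real (n choose Suc k) * f (Suc k)) = (\<Sum>k\<le>Suc n. real (n choose k) * f k)"
    by (subst sum.atMost_Suc_shift) simp
  finally show ?thesis by (simp add: sum.distrib algebra_simps)
qed

text \<open>With \<open>k\<close> counting the minus signs, the weights are the law of a sum of
  \<open>n\<close> random signs, and the power is its moment generating function at
  \<open>x\<close>.\<close>

lemma cosh_power_binomial:
  "cosh (x::real) ^ n = (\<Sum>k\<le>n. real (n choose k) / 2 ^ n * exp ((real n - 2 * real k) * x))"
proof -
  have "cosh x ^ n = (exp (- x) + exp x) ^ n / 2 ^ n"
    by (simp add: cosh_def power_divide add.commute)
  also have "\<dots> = (\<Sum>k\<le>n. real (n choose k) / 2 ^ n * (exp (- x) ^ k * exp x ^ (n - k)))"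
    by (simp add: binomial_ring sum_divide_distrib mult_ac)
  also have "\<dots> = (\<Sum>k\<le>n. real (n choose k) / 2 ^ n * exp ((real n - 2 * real k) * x))"
    by (intro sum.cong refl) (simp add: of_nat_diff algebra_simps flip: exp_of_nat_mult exp_add)
  finally show ?thesis .
qed

text \<open>The square of a Rademacher sum is sub-exponential: averaging out one sign turns the
  parameter \<open>a\<close> into at most \<open>a + 2 a\<^sup>2 \<theta>\<^sup>2\<close>, so that \<open>g\<close> bounds every parameter that occurs.\<close>

lemma rademacher_square_mgf_le:
  fixes a g \<theta> :: real
  assumes "0 \<le> a" "a + 2 * real n * \<theta>\<^sup>2 * g\<^sup>2 \<le> g"
  shows "(\<Sum>k\<le>n. real (n choose k) / 2 ^ n * exp (a * (\<theta> * (real n - 2 * real k))\<^sup>2))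
    \<le> exp (real n * \<theta>\<^sup>2 * g)"
  using assms
proof (induction n arbitrary: a)
  case 0
  then show ?case by simp
next
  case (Suc n)
  define z where "z k = \<theta> * (real n - 2 * real k)" for k
  have ag: "a \<le> g"
  proof -
    have "0 \<le> 2 * real (Suc n) * \<theta>\<^sup>2 * g\<^sup>2" by (intro mult_nonneg_nonneg) auto
    then show ?thesis using Suc.prems by linarith
  qed
  have aa: "a\<^sup>2 \<le> g\<^sup>2" using ag Suc.prems(1) by (intro power_mono) auto
  \<comment> \<open>The two values of the split-off sign: their cross terms form a
    \<open>cosh\<close>, whose Gaussian bound is absorbed into the coefficient of
    \<open>(z k)\<^sup>2\<close>.\<close>
  have step: "exp (a * (z k + \<theta>)\<^sup>2) + exp (a * (z k - \<theta>)\<^sup>2)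
      \<le> 2 * (exp (a * \<theta>\<^sup>2) * exp ((a + 2 * a\<^sup>2 * \<theta>\<^sup>2) * (z k)\<^sup>2))" for k
  proof -
    have "exp (a * (z k + \<theta>)\<^sup>2) + exp (a * (z k - \<theta>)\<^sup>2)
        = 2 * (exp (a * \<theta>\<^sup>2) * exp (a * (z k)\<^sup>2) * cosh (2 * a * \<theta> * z k))"
      by (simp add: cosh_def power2_eq_square algebra_simps flip: exp_add)
    also have "\<dots> \<le> 2 * (exp (a * \<theta>\<^sup>2) * exp (a * (z k)\<^sup>2) * exp ((2 * a * \<theta> * z k)\<^sup>2 / 2))"
      by (intro mult_left_mono cosh_le_exp_half_square) auto
    also have "\<dots> = 2 * (exp (a * \<theta>\<^sup>2) * exp ((a + 2 * a\<^sup>2 * \<theta>\<^sup>2) * (z k)\<^sup>2))"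
      by (simp add: power2_eq_square algebra_simps flip: exp_add)
    finally show ?thesis .
  qed
  have "(\<Sum>k\<le>Suc n. real (Suc n choose k) / 2 ^ Suc n * exp (a * (\<theta> * (real (Suc n) - 2 * real k))\<^sup>2))
      = (\<Sum>k\<le>Suc n. real (Suc n choose k) * (exp (a * (\<theta> * (real (Suc n) - 2 * real k))\<^sup>2) / 2 ^ Suc n))"
    by simp
  also have "\<dots> = (\<Sum>k\<le>n. real (n choose k) * (exp (a * (z k + \<theta>)\<^sup>2) / 2 ^ Suc n
        + exp (a * (z k - \<theta>)\<^sup>2) / 2 ^ Suc n))"
    unfolding sum_binomial_Suc by (simp add: z_def algebra_simps)
  also have "\<dots> = (\<Sum>k\<le>n. real (n choose k) / 2 ^ Suc n * (exp (a * (z k + \<theta>)\<^sup>2) + exp (a * (z k - \<theta>)\<^sup>2)))"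
    by (intro sum.cong refl) (simp add: add_divide_distrib algebra_simps)
  also have "\<dots> \<le> (\<Sum>k\<le>n. real (n choose k) / 2 ^ Suc n
      * (2 * (exp (a * \<theta>\<^sup>2) * exp ((a + 2 * a\<^sup>2 * \<theta>\<^sup>2) * (z k)\<^sup>2))))"
    by (intro sum_mono mult_left_mono step) auto
  also have "\<dots> = exp (a * \<theta>\<^sup>2) * (\<Sum>k\<le>n. real (n choose k) / 2 ^ n
      * exp ((a + 2 * a\<^sup>2 * \<theta>\<^sup>2) * (z k)\<^sup>2))"
    by (simp add: sum_distrib_left mult_ac)
  also have "\<dots> \<le> exp (a * \<theta>\<^sup>2) * exp (real n * \<theta>\<^sup>2 * g)"
    unfolding z_def
  proof (intro mult_left_mono Suc.IH)
    have "2 * a\<^sup>2 * \<theta>\<^sup>2 \<le> 2 * g\<^sup>2 * \<theta>\<^sup>2" using aa by (intro mult_right_mono) auto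
    then show "a + 2 * a\<^sup>2 * \<theta>\<^sup>2 + 2 * real n * \<theta>\<^sup>2 * g\<^sup>2 \<le> g"
      using Suc.prems(2) by (simp add: algebra_simps)
  qed (use Suc.prems in auto)
  also have "\<dots> \<le> exp (g * \<theta>\<^sup>2) * exp (real n * \<theta>\<^sup>2 * g)"
    using ag by (intro mult_right_mono) (auto intro: mult_right_mono)
  also have "\<dots> = exp (real (Suc n) * \<theta>\<^sup>2 * g)"
    by (simp add: algebra_simps flip: exp_add)
  finally show ?case .
qed

text \<open>The quadratic regime of the Huber comparison. With
  \<open>t = y\<^sup>2 / 4 \<le> 1\<close> one has
  \<open>exp t \<le> 1 + t + t\<^sup>2 \<le> 1 + 2 * t\<close>, and \<open>1 + 2 * t\<close> is a
  partial sum of the series of \<open>cosh y\<close>.\<close>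

lemma cosh_ge_exp_quadratic:
  assumes "\<bar>y\<bar> \<le> 2" shows "exp (y\<^sup>2 / 4) \<le> cosh (y::real)"
proof -
  have y: "y\<^sup>2 / 4 \<le> 1" using power_mono[OF assms, of 2] by simp
  have "exp (y\<^sup>2 / 4) \<le> 1 + y\<^sup>2 / 4 + (y\<^sup>2 / 4)\<^sup>2"
    using y by (intro exp_le_quadratic) auto
  also have "(y\<^sup>2 / 4)\<^sup>2 \<le> y\<^sup>2 / 4" using mult_left_mono[OF y, of "y\<^sup>2 / 4"] by (simp add: power2_eq_square)
  also have "1 + y\<^sup>2 / 4 + y\<^sup>2 / 4 = (\<Sum>i<3. if even i then y ^ i /\<^sub>R fact i else 0)"
    by (simp add: eval_nat_numeral)
  also have "\<dots> \<le> cosh y"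
    using cosh_converges[of y]
    by (intro sum_le_suminf[of "\<lambda>n. if even n then y ^ n /\<^sub>R fact n else 0", unfolded sums_unique[OF cosh_converges, symmetric]])
       (auto simp: sums_iff zero_le_even_power)
  finally show ?thesis by simp
qed

text \<open>The linear regime: \<open>cosh y\<close> is at least half of
  \<open>exp \<bar>y\<bar>\<close>, and \<open>exp (\<bar>y\<bar> / 2) \<ge> 2\<close> pays for the
  half.\<close>

lemma cosh_ge_exp_linear:
  assumes "2 \<le> \<bar>y\<bar>" shows "exp (\<bar>y\<bar> / 2) \<le> cosh (y::real)"
proof -
  have "2 \<le> exp (\<bar>y\<bar> / 2)" using exp_ge_add_one_self[of "\<bar>y\<bar> / 2"] assms by linarith
  then have "exp (\<bar>y\<bar> / 2) * 2 \<le> exp (\<bar>y\<bar> / 2) * exp (\<bar>y\<bar> / 2)" by (intro mult_left_mono) auto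
  also have "\<dots> = exp \<bar>y\<bar>" by (simp flip: exp_add)
  also have "\<dots> \<le> exp \<bar>y\<bar> + exp (- \<bar>y\<bar>)" by simp
  also have "\<dots> = 2 * cosh \<bar>y\<bar>" by (simp add: cosh_def)
  finally show ?thesis by simp
qed

subsection \<open>Noise of a symmetric Bernoulli matrix\<close>

text \<open>Only the entries with \<open>i \<le> j\<close> are drawn independently, so a bilinear
  form in the matrix is folded onto them before independence is used. The induction adds the last
  row and column together.\<close>

lemma sum_square_upper_triangle:
  fixes f :: "nat \<Rightarrow> nat \<Rightarrow> real"
  shows "(\<Sum>i<d. \<Sum>j<d. f i j) = (\<Sum>(i, j)\<in>{(i, j). i \<le> j \<and> j < d}. if i = j then f i i else f i j + f j i)"
proof (induction d)
  case 0
  then show ?case by simp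
next
  case (Suc d)
  have fin: "finite {(i, j). i \<le> j \<and> j < (d::nat)}"
    by (rule finite_subset[of _ "{..<d} \<times> {..<d}"]) auto
  have split: "{(i, j). i \<le> j \<and> j < Suc d} = {(i, j). i \<le> j \<and> j < d} \<union> (\<lambda>i. (i, d)) ` {..d}"
    by auto
  have "(\<Sum>i<Suc d. \<Sum>j<Suc d. f i j) = (\<Sum>i<d. \<Sum>j<d. f i j) + ((\<Sum>i<d. f i d + f d i) + f d d)"
    by (simp add: sum.distrib)
  also have "(\<Sum>i<d. f i d + f d i) + f d d = (\<Sum>i\<le>d. if i = d then f i i else f i d + f d i)"
    by (simp add: lessThan_Suc_atMost[symmetric])
  also have "\<dots> = (\<Sum>(i, j)\<in>(\<lambda>i. (i, d)) ` {..d}. if i = j then f i i else f i j + f j i)"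
    by (subst sum.reindex) (auto simp: inj_on_def)
  finally show ?case
    unfolding split Suc.IH by (subst sum.union_disjoint) (auto simp: fin)
qed

text \<open>The entry probabilities enter through the common bound \<open>p\<close>, so the noise
  estimates treat pairs inside and outside the cluster alike.\<close>

locale bernoulli_matrix =
  fixes d :: nat and p :: real and r :: "nat \<times> nat \<Rightarrow> real"
  assumes p_le_1: "p \<le> 1" and r_nonneg: "\<And>e. 0 \<le> r e" and r_le_p: "\<And>e. r e \<le> p"
begin

definition pairs :: "(nat \<times> nat) set" where
  "pairs = {(i, j). i \<le> j \<and> j < d}"

definition law :: "(nat \<times> nat \<Rightarrow> bool) pmf" where
  "law = Pi_pmf pairs False (\<lambda>e. bernoulli_pmf (r e))"

definition noise :: "(nat \<times> nat \<Rightarrow> bool) \<Rightarrow> nat \<Rightarrow> nat \<Rightarrow> real" where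
  "noise X i j = of_bool (X (min i j, max i j)) - r (min i j, max i j)"

definition noise_form :: "(nat \<times> nat \<Rightarrow> bool) \<Rightarrow> (nat \<Rightarrow> real) \<Rightarrow> (nat \<Rightarrow> real) \<Rightarrow> real" where
  "noise_form X x y = (\<Sum>i<d. \<Sum>j<d. noise X i j * x i * y j)"

lemma p_nonneg: "0 \<le> p"
  using r_nonneg r_le_p order_trans by blast

lemma finite_pairs: "finite pairs"
  unfolding pairs_def by (rule finite_subset[of _ "{..<d} \<times> {..<d}"]) auto

lemma integrable_law: "integrable (measure_pmf law) (f :: _ \<Rightarrow> real)"
proof (rule integrable_measure_pmf_finite)
  have "set_pmf law \<subseteq> PiE_dflt pairs False (\<lambda>e. set_pmf (bernoulli_pmf (r e)))"
    unfolding law_def by (simp add: set_Pi_pmf finite_pairs comp_def)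
  also have "finite \<dots>"
    by (rule finite_PiE_dflt[OF finite_pairs]) (auto intro: finite_subset[OF subset_UNIV])
  finally (finite_subset) show "finite (set_pmf law)" .
qed

lemma noise_sym: "noise X i j = noise X j i"
  by (simp add: noise_def min.commute max.commute)

lemma noise_form_row: "noise_form X x y = (\<Sum>i<d. x i * (\<Sum>j<d. noise X i j * y j))"
  unfolding noise_form_def by (simp add: sum_distrib_left mult_ac)

lemma linear_mgf_le:
  assumes "\<And>e. e \<in> pairs \<Longrightarrow> \<bar>b e\<bar> \<le> 1"
  shows "measure_pmf.expectation law (\<lambda>X. exp (\<Sum>e\<in>pairs. b e * (of_bool (X e) - r e)))
    \<le> exp (p * (\<Sum>e\<in>pairs. (b e)\<^sup>2))"
proof -
  have "measure_pmf.expectation law (\<lambda>X. exp (\<Sum>e\<in>pairs. b e * (of_bool (X e) - r e)))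
      = measure_pmf.expectation law (\<lambda>X. \<Prod>e\<in>pairs. exp (b e * (of_bool (X e) - r e)))"
    by (simp add: exp_sum finite_pairs)
  also have "\<dots> = (\<Prod>e\<in>pairs. measure_pmf.expectation (bernoulli_pmf (r e)) (\<lambda>v. exp (b e * (of_bool v - r e))))"
    unfolding law_def
    by (rule expectation_prod_Pi_pmf[OF finite_pairs])
       (auto intro!: integrable_measure_pmf_finite intro: finite_subset[OF subset_UNIV])
  also have "\<dots> \<le> (\<Prod>e\<in>pairs. exp (p * (b e)\<^sup>2))"
    using assms r_nonneg r_le_p p_le_1
    by (intro prod_mono conjI bernoulli_mgf_le integral_nonneg_AE) auto
  finally show ?thesis by (simp add: exp_sum finite_pairs sum_distrib_left)
qed

text \<open>An off-diagonal entry occurs twice, with total coefficient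
  \<open>x i * y j + x j * y i\<close>. The bound 1/2 on the products keeps it at most 1 in absolute
  value, and squaring it costs the factor 2.\<close>

lemma noise_form_mgf_le:
  assumes "\<And>i j. i < d \<Longrightarrow> j < d \<Longrightarrow> \<bar>x i * y j\<bar> \<le> 1/2"
  shows "measure_pmf.expectation law (\<lambda>X. exp (noise_form X x y))
    \<le> exp (2 * p * (\<Sum>i<d. (x i)\<^sup>2) * (\<Sum>j<d. (y j)\<^sup>2))"
proof -
  define b where "b = (\<lambda>(i, j). if i = j then x i * y i else x i * y j + x j * y i)"
  have "noise_form X x y = (\<Sum>e\<in>pairs. b e * (of_bool (X e) - r e))" for X
    unfolding noise_form_def sum_square_upper_triangle pairs_def
    by (intro sum.cong refl) (auto simp: b_def noise_def min_def max_def algebra_simps)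
  then have "measure_pmf.expectation law (\<lambda>X. exp (noise_form X x y))
    = measure_pmf.expectation law (\<lambda>X. exp (\<Sum>e\<in>pairs. b e * (of_bool (X e) - r e)))"
    by simp
  also have "\<dots> \<le> exp (p * (\<Sum>e\<in>pairs. (b e)\<^sup>2))"
  proof (rule linear_mgf_le)
    fix e assume "e \<in> pairs"
    then obtain i j where e: "e = (i, j)" "i < d" "j < d" by (auto simp: pairs_def)
    have "\<bar>x i * y j\<bar> \<le> 1/2" "\<bar>x j * y i\<bar> \<le> 1/2" "\<bar>x i * y i\<bar> \<le> 1/2"
      using assms e by blast+
    then show "\<bar>b e\<bar> \<le> 1" unfolding e b_def split by (split if_split) linarith
  qed
  also have "\<dots> \<le> exp (p * (2 * ((\<Sum>i<d. (x i)\<^sup>2) * (\<Sum>j<d. (y j)\<^sup>2))))"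
  proof -
    \<comment> \<open>The diagonal receives the factor 2 as well, so that the triangle unfolds into
      the full square.\<close>
    have "(\<Sum>e\<in>pairs. (b e)\<^sup>2) \<le> (\<Sum>(i, j)\<in>pairs. if i = j then 2 * ((x i)\<^sup>2 * (y i)\<^sup>2)
        else 2 * ((x i)\<^sup>2 * (y j)\<^sup>2) + 2 * ((x j)\<^sup>2 * (y i)\<^sup>2))"
    proof (rule sum_mono)
      fix e :: "nat \<times> nat"
      obtain i j where e: "e = (i, j)" by force
      have "(x i * y j + x j * y i)\<^sup>2 \<le> 2 * (x i * y j)\<^sup>2 + 2 * (x j * y i)\<^sup>2"
        using sum_squares_bound[of "x i * y j" "x j * y i"] by (simp add: power2_sum)
      then show "(b e)\<^sup>2 \<le> (case e of (i, j) \<Rightarrow> if i = j then 2 * ((x i)\<^sup>2 * (y i)\<^sup>2)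
        else 2 * ((x i)\<^sup>2 * (y j)\<^sup>2) + 2 * ((x j)\<^sup>2 * (y i)\<^sup>2))"
        by (simp add: e b_def power_mult_distrib)
    qed
    also have "\<dots> = (\<Sum>i<d. \<Sum>j<d. 2 * ((x i)\<^sup>2 * (y j)\<^sup>2))"
      unfolding sum_square_upper_triangle pairs_def by simp
    also have "\<dots> = 2 * ((\<Sum>i<d. (x i)\<^sup>2) * (\<Sum>j<d. (y j)\<^sup>2))"
      unfolding sum_product by (simp add: sum_distrib_left)
    finally show ?thesis using p_nonneg by (auto intro: mult_left_mono)
  qed
  finally show ?thesis by (simp add: mult_ac)
qed

lemma prob_le_expectation:
  assumes "\<And>X. P X \<Longrightarrow> 1 \<le> f X" "\<And>X. 0 \<le> f X"
  shows "measure_pmf.prob law {X. P X} \<le> measure_pmf.expectation law f"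
proof -
  have "measure_pmf.prob law {X. P X} = measure_pmf.expectation law (indicator {X. P X})"
    by simp
  also have "\<dots> \<le> measure_pmf.expectation law f"
    using assms by (intro integral_mono integrable_law) (auto simp: indicator_def)
  finally show ?thesis .
qed

text \<open>Chernoff's bound with \<open>\<theta>\<close> left free. By \<open>var\<close> the
  second-order term consumes at most half of the gain \<open>\<theta> * z\<close>.\<close>

lemma noise_form_tail:
  assumes z: "0 \<le> z" and \<theta>: "0 \<le> \<theta>" "\<theta> \<le> 1/2"
    and x: "\<And>i. i < d \<Longrightarrow> \<bar>x i\<bar> \<le> 1" and y: "\<And>i. i < d \<Longrightarrow> \<bar>y i\<bar> \<le> 1"
    and var: "4 * p * (\<Sum>i<d. (x i)\<^sup>2) * (\<Sum>i<d. (y i)\<^sup>2) * \<theta> \<le> z"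
  shows "measure_pmf.prob law {X. z < noise_form X x y} \<le> exp (- (\<theta> * z / 2))"
proof -
  have form: "noise_form X (\<lambda>i. \<theta> * x i) y = \<theta> * noise_form X x y" for X
    by (simp add: noise_form_def sum_distrib_left mult_ac)
  have "measure_pmf.prob law {X. z < noise_form X x y}
      \<le> measure_pmf.expectation law (\<lambda>X. exp (- (\<theta> * z)) * exp (noise_form X (\<lambda>i. \<theta> * x i) y))"
    using \<theta> by (intro prob_le_expectation) (auto simp: form mult_left_mono simp flip: exp_add)
  also have "\<dots> = exp (- (\<theta> * z)) * measure_pmf.expectation law (\<lambda>X. exp (noise_form X (\<lambda>i. \<theta> * x i) y))"
    by simp
  also have "\<dots> \<le> exp (- (\<theta> * z)) * exp (2 * p * (\<Sum>i<d. (\<theta> * x i)\<^sup>2) * (\<Sum>i<d. (y i)\<^sup>2))"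
  proof (intro mult_left_mono noise_form_mgf_le)
    fix i j assume ij: "i < d" "j < d"
    have "\<bar>\<theta>\<bar> * (\<bar>x i\<bar> * \<bar>y j\<bar>) \<le> 1/2 * 1"
      using \<theta> x[OF ij(1)] y[OF ij(2)] by (intro mult_mono mult_le_one) auto
    then show "\<bar>\<theta> * x i * y j\<bar> \<le> 1/2" by (simp add: abs_mult mult.assoc)
  qed auto
  also have "\<dots> = exp (- (\<theta> * z) + \<theta> * (4 * p * (\<Sum>i<d. (x i)\<^sup>2) * (\<Sum>i<d. (y i)\<^sup>2) * \<theta>) / 2)"
    by (simp add: power_mult_distrib sum_distrib_left[symmetric] power2_eq_square mult_ac flip: exp_add)
  also have "\<dots> \<le> exp (- (\<theta> * z / 2))"
    using mult_left_mono[OF var \<theta>(1)] by (simp only: exp_le_cancel_iff)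
  finally show ?thesis .
qed

text \<open>Expanding each factor by \<open>cosh_power_binomial\<close> gives an average of
  exponentials of bilinear forms in the noise. Once the noise is integrated out the rows separate
  again, and \<open>rademacher_square_mgf_le\<close> bounds each of them.\<close>

lemma prod_cosh_mgf_le:
  assumes S: "S \<subseteq> {..<d}" and \<theta>: "0 \<le> \<theta>" "real n * \<theta> \<le> 1/2"
    and small: "16 * p * real (card S) * (real n * \<theta>\<^sup>2) \<le> 1"
  shows "measure_pmf.expectation law (\<lambda>X. \<Prod>i<d. cosh (\<theta> * (\<Sum>j\<in>S. noise X i j)) ^ n)
    \<le> exp (4 * p * real (card S) * (real n * \<theta>\<^sup>2) * real d)"
proof -
  define c where "c k = real (n choose k) / 2 ^ n" for k
  define \<xi> where "\<xi> k = \<theta> * (real n - 2 * real k)" for k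
  define a where "a = 2 * p * real (card S)"
  \<comment> \<open>A point of \<open>K\<close> records the number of minus signs in every row;
    \<open>\<xi> (\<kappa> i)\<close> is the scaled sign sum of row \<open>i\<close>.\<close>
  define K where "K = PiE {..<d} (\<lambda>_. {..n})"
  have fin: "finite K" unfolding K_def by (rule finite_PiE) auto
  have finS: "finite S" using S finite_subset by blast
  have c0: "0 \<le> c k" for k by (simp add: c_def)
  have sumS: "(\<Sum>j<d. (indicator S j)\<^sup>2) = real (card S)"
    using S finS by (simp add: power2_eq_square indicator_def if_distrib sum.If_cases Int_absorb1 cong: if_cong)
  have \<xi>_le: "\<bar>\<xi> k\<bar> \<le> 1/2" if "k \<le> n" for k
  proof -
    have "\<theta> * \<bar>real n - 2 * real k\<bar> \<le> \<theta> * real n" using that \<theta>(1) by (intro mult_left_mono) auto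
    then show ?thesis using \<theta> by (simp add: \<xi>_def abs_mult mult.commute)
  qed
  have "(\<Prod>i<d. cosh (\<theta> * (\<Sum>j\<in>S. noise X i j)) ^ n)
      = (\<Sum>\<kappa>\<in>K. (\<Prod>i<d. c (\<kappa> i)) * exp (noise_form X (\<lambda>i. \<xi> (\<kappa> i)) (indicator S)))" for X
  proof -
    have "(\<Sum>j\<in>S. noise X i j) = (\<Sum>j<d. noise X i j * indicator S j)" for i
      using S finS by (simp add: indicator_def if_distrib sum.If_cases Int_absorb1 cong: if_cong)
    then have "(\<Prod>i<d. cosh (\<theta> * (\<Sum>j\<in>S. noise X i j)) ^ n)
      = (\<Prod>i<d. \<Sum>k\<le>n. c k * exp (\<xi> k * (\<Sum>j<d. noise X i j * indicator S j)))"
      by (simp add: cosh_power_binomial c_def \<xi>_def mult_ac)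
    also have "\<dots> = (\<Sum>\<kappa>\<in>K. \<Prod>i<d. c (\<kappa> i) * exp (\<xi> (\<kappa> i) * (\<Sum>j<d. noise X i j * indicator S j)))"
      unfolding K_def by (rule prod_sum_PiE) auto
    finally show ?thesis
      by (simp add: prod.distrib noise_form_row exp_sum)
  qed
  then have "measure_pmf.expectation law (\<lambda>X. \<Prod>i<d. cosh (\<theta> * (\<Sum>j\<in>S. noise X i j)) ^ n)
     = (\<Sum>\<kappa>\<in>K. (\<Prod>i<d. c (\<kappa> i)) * measure_pmf.expectation law
          (\<lambda>X. exp (noise_form X (\<lambda>i. \<xi> (\<kappa> i)) (indicator S))))"
    by (simp add: Bochner_Integration.integral_sum integrable_law)
  also have "\<dots> \<le> (\<Sum>\<kappa>\<in>K. (\<Prod>i<d. c (\<kappa> i)) * exp (2 * p * (\<Sum>i<d. (\<xi> (\<kappa> i))\<^sup>2) * (\<Sum>j<d. (indicator S j)\<^sup>2)))"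
  proof (intro sum_mono mult_left_mono noise_form_mgf_le prod_nonneg)
    fix \<kappa> i j assume "\<kappa> \<in> K" "i < d" "j < d"
    then have "\<bar>\<xi> (\<kappa> i)\<bar> \<le> 1/2" by (intro \<xi>_le) (auto simp: K_def)
    then show "\<bar>\<xi> (\<kappa> i) * indicator S j\<bar> \<le> 1/2" by (simp add: indicator_def)
  qed (auto simp: c0)
  also have "\<dots> = (\<Sum>\<kappa>\<in>K. \<Prod>i<d. c (\<kappa> i) * exp (a * (\<xi> (\<kappa> i))\<^sup>2))"
    by (simp add: sumS a_def prod.distrib sum_distrib_left mult_ac flip: exp_sum)
  also have "\<dots> = (\<Prod>i<d. \<Sum>k\<le>n. c k * exp (a * (\<xi> k)\<^sup>2))"
    unfolding K_def by (rule prod_sum_PiE[symmetric]) auto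
  \<comment> \<open>Here \<open>g = 2 * a\<close>: \<open>small\<close> reads
    \<open>8 * n * \<theta>\<^sup>2 * a \<le> 1\<close>, which is what the growth from
    \<open>a\<close> to \<open>g\<close> requires.\<close>
  also have "\<dots> \<le> (\<Prod>i<d. exp (real n * \<theta>\<^sup>2 * (2 * a)))"
  proof (intro prod_mono conjI sum_nonneg)
    have a0: "0 \<le> a" using p_nonneg by (simp add: a_def)
    have "a * (8 * real n * \<theta>\<^sup>2 * a) \<le> a * 1"
      using small a0 by (intro mult_left_mono) (auto simp: a_def mult_ac)
    then have "a + 2 * real n * \<theta>\<^sup>2 * (2 * a)\<^sup>2 \<le> 2 * a"
      by (simp add: power2_eq_square mult_ac)
    then show "(\<Sum>k\<le>n. c k * exp (a * (\<xi> k)\<^sup>2)) \<le> exp (real n * \<theta>\<^sup>2 * (2 * a))"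
      unfolding c_def \<xi>_def using a0 by (intro rademacher_square_mgf_le)
  qed (auto simp: c0)
  also have "\<dots> = exp (4 * p * real (card S) * (real n * \<theta>\<^sup>2) * real d)"
    by (simp add: a_def mult_ac flip: exp_of_nat_mult)
  finally show ?thesis .
qed

end

section \<open>Entropy of index sets, tail estimates and union bounds\<close>

text \<open>The bound \<open>(exp 1 * d / s) ^ s\<close>; it follows because
  \<open>s ^ s / fact s\<close> is one term of the series of \<open>exp s\<close>.\<close>

lemma binomial_le_exp:
  assumes "1 \<le> s" "s \<le> d"
  shows "real (d choose s) \<le> exp (real s * (1 + ln (real d / real s)))"
proof -
  have "real s ^ s / fact s \<le> (\<Sum>n<Suc s. real s ^ n / fact n)"
    by (rule member_le_sum[of s "{..<Suc s}" "\<lambda>n. real s ^ n / fact n"]) auto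
  also have "\<dots> \<le> exp (real s)"
    using exp_converges[of "real s"]
    by (intro order.trans[OF sum_le_suminf[of "\<lambda>n. real s ^ n / fact n"]])
       (auto simp: sums_iff divide_inverse_commute)
  finally have s: "real s ^ s / fact s \<le> exp (real s)" .
  have "real (d choose s) * fact s \<le> real d ^ s"
    using of_nat_mono[OF binomial_fact_pow[of d s], where ?'a = real] by simp
  then have "real (d choose s) \<le> (real d / real s) ^ s * (real s ^ s / fact s)"
    using assms by (simp add: power_divide field_simps)
  also have "\<dots> \<le> (real d / real s) ^ s * exp (real s)"
    by (intro mult_left_mono s) auto
  also have "(real d / real s) ^ s = exp (real s * ln (real d / real s))"
    using assms by (simp add: exp_of_nat_mult)
  finally show ?thesis by (simp add: ring_distribs exp_add mult.commute)
qed

text \<open>Makes failure probabilities polynomially small in \<open>d\<close> at every size,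
  singletons included. The difference of the sides is
  \<open>(s - 1 - ln s) + (s - 1) * (ln d - ln s)\<close>.\<close>

lemma entropy_ge:
  assumes "1 \<le> s" "s \<le> d"
  shows "1 + ln (real d) \<le> real s * (1 + ln (real d / real s))"
proof -
  have "ln (real s) \<le> real s - 1" using assms by (intro ln_le_minus_one) auto
  moreover have "(real s - 1) * ln (real s) \<le> (real s - 1) * ln (real d)"
    using assms by (intro mult_left_mono) auto
  ultimately show ?thesis using assms by (simp add: ln_div algebra_simps)
qed

lemma entropy_le:
  assumes "1 \<le> s" "s \<le> d"
  shows "real s * (1 + ln (real d / real s)) \<le> real d"
proof -
  have "ln (real d / real s) \<le> real d / real s - 1" using assms by (intro ln_le_minus_one) auto
  then have "real s * (1 + ln (real d / real s)) \<le> real s * (real d / real s)"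
    by (intro mult_left_mono) auto
  then show ?thesis using assms by simp
qed

text \<open>Eliminating \<open>w\<close>: the left-hand exponent is \<open>\<kappa>\<close> times a Huber function of \<open>x\<close>, and so is
  \<open>ln cosh\<close> up to constants.\<close>

lemma exp_huber_le_cosh_power:
  fixes x w e \<kappa> :: real
  assumes n: "1 \<le> n" and \<kappa>: "0 \<le> \<kappa>" "\<kappa> \<le> 1/4" and e: "0 < e" and ne: "4 * real n * \<kappa> \<le> e" and w: "\<bar>w\<bar> \<le> 1"
  shows "exp (\<kappa> * (x * w - e * w\<^sup>2)) \<le> cosh (x / (2 * real n)) ^ n"
proof (cases "\<bar>x / (2 * real n)\<bar> \<le> 2")
  case True
  have "0 \<le> (x - 2 * e * w)\<^sup>2 / (4 * e)" using e by simp
  also have "\<dots> = x\<^sup>2 / (4 * e) - (x * w - e * w\<^sup>2)"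
    using e by (simp add: power2_eq_square field_simps)
  finally have "\<kappa> * (x * w - e * w\<^sup>2) \<le> \<kappa> * (x\<^sup>2 / (4 * e))"
    using \<kappa> by (intro mult_left_mono) auto
  also have "\<dots> = (4 * real n * \<kappa>) * (x\<^sup>2 / (16 * real n * e))" using n by (simp add: field_simps)
  also have "\<dots> \<le> e * (x\<^sup>2 / (16 * real n * e))" using e by (intro mult_right_mono ne) auto
  also have "\<dots> = real n * ((x / (2 * real n))\<^sup>2 / 4)"
    using n e by (simp add: power2_eq_square field_simps)
  finally have "exp (\<kappa> * (x * w - e * w\<^sup>2)) \<le> exp ((x / (2 * real n))\<^sup>2 / 4) ^ n"
    by (simp flip: exp_of_nat_mult)
  also have "\<dots> \<le> cosh (x / (2 * real n)) ^ n"
    by (intro power_mono cosh_ge_exp_quadratic True) auto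
  finally show ?thesis .
next
  case False
  have "\<kappa> * (x * w - e * w\<^sup>2) \<le> \<kappa> * \<bar>x\<bar>"
  proof (intro mult_left_mono \<kappa>)
    have "x * w \<le> \<bar>x\<bar> * \<bar>w\<bar>" by (metis abs_ge_self abs_mult)
    also have "\<dots> \<le> \<bar>x\<bar> * 1" using w by (intro mult_left_mono) auto
    finally have "x * w \<le> \<bar>x\<bar>" by simp
    moreover have "0 \<le> e * w\<^sup>2" using e by simp
    ultimately show "x * w - e * w\<^sup>2 \<le> \<bar>x\<bar>" by linarith
  qed
  also have "\<dots> \<le> 1/4 * \<bar>x\<bar>" using \<kappa> by (intro mult_right_mono) auto
  also have "\<dots> = real n * (\<bar>x / (2 * real n)\<bar> / 2)" using n by simp
  finally have "exp (\<kappa> * (x * w - e * w\<^sup>2)) \<le> exp (\<bar>x / (2 * real n)\<bar> / 2) ^ n"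
    by (simp flip: exp_of_nat_mult)
  also have "\<dots> \<le> cosh (x / (2 * real n)) ^ n"
    using False by (intro power_mono cosh_ge_exp_linear) auto
  finally show ?thesis .
qed

context bernoulli_matrix
begin

text \<open>The event that the supremum over the cube of a linear form with quadratic penalty
  exceeds \<open>e * card S\<close>. That supremum is a sum of Huber functions of the row sums over
  \<open>S\<close>.\<close>

definition set_deviation :: "real \<Rightarrow> nat set \<Rightarrow> (nat \<times> nat \<Rightarrow> bool) \<Rightarrow> bool" where
  "set_deviation e S X \<longleftrightarrow> (\<exists>w. (\<forall>i<d. \<bar>w i\<bar> \<le> 1) \<and>
     e * (real (card S) + (\<Sum>i<d. (w i)\<^sup>2)) < (\<Sum>i<d. w i * (\<Sum>j\<in>S. noise X i j)))"

text \<open>Markov's inequality gains \<open>exp (- 7 * s * L)\<close> and the moment costs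
  \<open>exp (s * L)\<close>. What remains is six times the entropy \<open>s * L\<close>, one of
  which pays for choosing \<open>S\<close>.\<close>

lemma prob_set_deviation_le:
  assumes S: "S \<subseteq> {..<d}" "S \<noteq> {}" and e: "1 \<le> e" and var: "224 * p * real d \<le> e\<^sup>2"
  defines "L \<equiv> 1 + ln (real d / real (card S))"
  assumes eL: "28 * L \<le> e"
  shows "measure_pmf.prob law {X. set_deviation e S X} \<le> exp (- 6 * (real (card S) * L))"
proof -
  define s where "s = card S"
  have fin: "finite S" using S(1) finite_subset by blast
  have s: "1 \<le> s" "s \<le> d"
    using S fin card_gt_0_iff[of S] card_mono[OF _ S(1)] by (auto simp: s_def)
  have L: "1 \<le> L" using s by (simp add: L_def s_def)
  have sL: "real s * L \<le> real d" unfolding L_def s_def[symmetric] by (rule entropy_le[OF s])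
  \<comment> \<open>Chosen so that \<open>\<kappa> * (e * s) = 7 * s * L\<close>; \<open>eL\<close>
    then says \<open>\<kappa> \<le> 1/4\<close>.\<close>
  define \<kappa> where "\<kappa> = 7 * L / e"
  \<comment> \<open>The largest \<open>n\<close> with \<open>4 * n * \<kappa> \<le> e\<close>.
    Rounding loses at most a factor 2, so 28 becomes 56 in \<open>n2\<close>, and 224 in
    \<open>var\<close> is \<open>4 * 56\<close>.\<close>
  define n where "n = nat \<lfloor>e\<^sup>2 / (28 * L)\<rfloor>"
  have "1 * 1 \<le> (e / (28 * L)) * e" using e eL L by (intro mult_mono) auto
  then have q: "1 \<le> e\<^sup>2 / (28 * L)" by (simp add: power2_eq_square)
  then have n: "1 \<le> n" "real n \<le> e\<^sup>2 / (28 * L)" "e\<^sup>2 / (28 * L) < real n + 1"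
    by (auto simp: n_def le_nat_iff)
  then have "e\<^sup>2 / (28 * L) \<le> 2 * real n" by linarith
  then have n2: "e\<^sup>2 \<le> 56 * L * real n"
    using L by (simp add: pos_divide_le_eq mult_ac)
  \<comment> \<open>Gives \<open>n * \<theta> = 1/2\<close> and matches the argument of
    \<open>cosh\<close> in \<open>exp_huber_le_cosh_power\<close>.\<close>
  define \<theta> where "\<theta> = 1 / (2 * real n)"
  have n\<theta>: "real n * \<theta>\<^sup>2 = 1 / (4 * real n)" using n(1) by (simp add: \<theta>_def power2_eq_square)
  have pd: "4 * p * real d \<le> L * real n" using var n2 by simp
  have psd: "p * real s * real d / real n \<le> real s * L"
  proof -
    have "real s * (p * real d) \<le> real s * (L * real n)"
      using pd p_nonneg by (intro mult_left_mono) (auto intro: order.trans[rotated])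
    then show ?thesis using n(1) by (simp add: field_simps)
  qed
  have ps: "4 * p * real s / real n \<le> 1"
  proof -
    have "L * (4 * p * real s) \<le> 4 * p * real d"
      using mult_left_mono[OF sL, of "4 * p"] p_nonneg by (simp add: mult_ac)
    also note pd
    finally show ?thesis using L n(1) by simp
  qed
  have Markov: "1 \<le> exp (- 7 * (real s * L)) * (\<Prod>i<d. cosh (\<theta> * (\<Sum>j\<in>S. noise X i j)) ^ n)"
    if dev: "set_deviation e S X" for X
  proof -
    define x where "x i = (\<Sum>j\<in>S. noise X i j)" for i
    from dev obtain w where w: "\<And>i. i < d \<Longrightarrow> \<bar>w i\<bar> \<le> 1"
      and "e * (real s + (\<Sum>i<d. (w i)\<^sup>2)) < (\<Sum>i<d. w i * x i)"
      unfolding set_deviation_def x_def s_def by blast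
    then have "e * real s \<le> (\<Sum>i<d. x i * w i - e * (w i)\<^sup>2)"
      by (simp add: sum_subtractf sum_distrib_left algebra_simps)
    then have "\<kappa> * (e * real s) \<le> \<kappa> * (\<Sum>i<d. x i * w i - e * (w i)\<^sup>2)"
      using L e by (intro mult_left_mono) (auto simp: \<kappa>_def)
    then have "7 * (real s * L) \<le> (\<Sum>i<d. \<kappa> * (x i * w i - e * (w i)\<^sup>2))"
      using e by (simp add: \<kappa>_def sum_distrib_left mult_ac)
    then have "exp (7 * (real s * L)) \<le> (\<Prod>i<d. exp (\<kappa> * (x i * w i - e * (w i)\<^sup>2)))"
      by (simp flip: exp_sum)
    also have "\<dots> \<le> (\<Prod>i<d. cosh (x i / (2 * real n)) ^ n)"
    proof (intro prod_mono conjI exp_huber_le_cosh_power)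
      show "4 * real n * \<kappa> \<le> e"
        using n(2) L e by (simp add: \<kappa>_def field_simps power2_eq_square)
      show "\<kappa> \<le> 1/4" using eL e by (simp add: \<kappa>_def field_simps)
    qed (use n e L w in \<open>auto simp: \<kappa>_def\<close>)
    finally have "exp (7 * (real s * L)) \<le> (\<Prod>i<d. cosh (\<theta> * x i) ^ n)"
      by (simp add: \<theta>_def)
    then have "exp (- 7 * (real s * L)) * exp (7 * (real s * L))
        \<le> exp (- 7 * (real s * L)) * (\<Prod>i<d. cosh (\<theta> * x i) ^ n)"
      by (intro mult_left_mono) auto
    then show ?thesis by (simp add: x_def flip: exp_add)
  qed
  have "measure_pmf.prob law {X. set_deviation e S X}
     \<le> measure_pmf.expectation law
        (\<lambda>X. exp (- 7 * (real s * L)) * (\<Prod>i<d. cosh (\<theta> * (\<Sum>j\<in>S. noise X i j)) ^ n))"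
    by (intro prob_le_expectation Markov mult_nonneg_nonneg prod_nonneg) auto
  also have "\<dots> = exp (- 7 * (real s * L))
      * measure_pmf.expectation law (\<lambda>X. \<Prod>i<d. cosh (\<theta> * (\<Sum>j\<in>S. noise X i j)) ^ n)"
    by simp
  also have "\<dots> \<le> exp (- 7 * (real s * L)) * exp (4 * p * real (card S) * (real n * \<theta>\<^sup>2) * real d)"
    by (intro mult_left_mono prod_cosh_mgf_le S(1))
       (use n(1) ps in \<open>simp_all add: n\<theta>, simp_all add: \<theta>_def s_def field_simps\<close>)
  also have "\<dots> \<le> exp (- 7 * (real s * L)) * exp (real s * L)"
    using psd n(1) by (intro mult_left_mono) (simp_all add: n\<theta> s_def field_simps)
  also have "\<dots> = exp (- 6 * (real (card S) * L))"
    by (simp add: s_def flip: exp_add)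
  finally show ?thesis .
qed

lemma prob_UN_le:
  assumes "finite I" "\<And>i. i \<in> I \<Longrightarrow> measure_pmf.prob law {X. P i X} \<le> b i"
  shows "measure_pmf.prob law {X. \<exists>i\<in>I. P i X} \<le> sum b I"
proof -
  have "{X. \<exists>i\<in>I. P i X} = (\<Union>i\<in>I. {X. P i X})" by auto
  then have "measure_pmf.prob law {X. \<exists>i\<in>I. P i X} \<le> (\<Sum>i\<in>I. measure_pmf.prob law {X. P i X})"
    using assms(1) by (simp add: measure_pmf.finite_measure_subadditive_finite)
  also have "\<dots> \<le> sum b I" by (intro sum_mono assms(2))
  finally show ?thesis .
qed

text \<open>At most \<open>exp (H s)\<close> sets have size \<open>s\<close>, which leaves
  \<open>exp (- 5 * H s) \<le> exp (- 5) / d ^ 5\<close> per size; the \<open>d\<close> sizes cost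
  one power of \<open>d\<close>.\<close>

lemma prob_some_set_deviation_le:
  assumes d: "2 \<le> d" and e: "84 * ln (real d) \<le> e" and var: "224 * p * real d \<le> e\<^sup>2"
  shows "measure_pmf.prob law {X. \<exists>S\<in>Pow {..<d}. set_deviation e S X} \<le> 1 / (2 * real d ^ 3)"
proof -
  define H where "H s = real s * (1 + ln (real d / real s))" for s
  \<comment> \<open>This bounds \<open>1 + ln d\<close> by \<open>3 * ln d\<close>, whence
    \<open>84 = 3 * 28\<close>.\<close>
  have ln2: "1/2 \<le> ln (real d)"
  proof -
    have "exp (1/2) \<le> (2::real)" using exp_bound_half[of "1/2::real"] by simp
    also have "\<dots> \<le> real d" using d by simp
    finally show ?thesis using d by (subst ln_ge_iff) auto
  qed
  have e1: "1 \<le> e" using e ln2 by linarith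
  define subsets where "subsets s = {S. S \<subseteq> {..<d} \<and> card S = s}" for s
  have H: "1 + ln (real d) \<le> H s" if "s \<in> {1..d}" for s
    using entropy_ge[of s d] that by (simp add: H_def)
  have fixed_size: "measure_pmf.prob law {X. \<exists>S\<in>subsets s. set_deviation e S X} \<le> exp (- 5) / real d ^ 5"
    if s: "s \<in> {1..d}" for s
  proof -
    have "measure_pmf.prob law {X. set_deviation e S X} \<le> exp (- 6 * H s)" if S: "S \<in> subsets s" for S
    proof -
      have "ln (real d / real s) \<le> ln (real d)" using s by (simp add: ln_div)
      then have "28 * (1 + ln (real d / real s)) \<le> 28 * (1 + ln (real d))" by simp
      also have "\<dots> \<le> 84 * ln (real d)" using ln2 by simp
      also note e
      finally have "28 * (1 + ln (real d / real s)) \<le> e" .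
      moreover have "S \<subseteq> {..<d}" "S \<noteq> {}" "card S = s" using S s by (auto simp: subsets_def)
      ultimately show ?thesis
        using prob_set_deviation_le[of S e] e1 var by (simp add: H_def)
    qed
    then have "measure_pmf.prob law {X. \<exists>S\<in>subsets s. set_deviation e S X} \<le> (\<Sum>S\<in>subsets s. exp (- 6 * H s))"
      by (intro prob_UN_le) (auto simp: subsets_def)
    also have "\<dots> = real (d choose s) * exp (- 6 * H s)"
      using n_subsets[of "{..<d}" s] by (simp add: subsets_def)
    also have "\<dots> \<le> exp (H s) * exp (- 6 * H s)"
      using s binomial_le_exp[of s d] by (intro mult_right_mono) (auto simp: H_def)
    also have "\<dots> \<le> exp (- 5 * (1 + ln (real d)))"
      using H[OF s] by (simp flip: exp_add)
    also have "\<dots> = exp (- 5) / exp (ln (real d)) ^ 5"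
      by (simp add: exp_diff ring_distribs flip: exp_of_nat_mult)
    finally show ?thesis using d by simp
  qed
  \<comment> \<open>The entropy bounds start at size 1; for the empty set the row sums vanish and no
    deviation can occur.\<close>
  have no_empty: "\<not> set_deviation e {} X" for X
    using e1 by (auto simp: set_deviation_def not_less intro!: mult_nonneg_nonneg sum_nonneg)
  have "{X. \<exists>S\<in>Pow {..<d}. set_deviation e S X} \<subseteq> {X. \<exists>s\<in>{1..d}. \<exists>S\<in>subsets s. set_deviation e S X}"
  proof safe
    fix X S assume S: "S \<subseteq> {..<d}" "set_deviation e S X"
    then have "S \<noteq> {}" "finite S" using no_empty finite_subset by auto
    then have "card S \<in> {1..d}"
      using card_mono[OF _ S(1)] card_gt_0_iff[of S] by auto
    then show "\<exists>s\<in>{1..d}. \<exists>S\<in>subsets s. set_deviation e S X"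
      using S by (intro bexI[of _ "card S"] bexI[of _ S]) (auto simp: subsets_def)
  qed
  then have "measure_pmf.prob law {X. \<exists>S\<in>Pow {..<d}. set_deviation e S X}
      \<le> measure_pmf.prob law {X. \<exists>s\<in>{1..d}. \<exists>S\<in>subsets s. set_deviation e S X}"
    by (intro measure_pmf.finite_measure_mono) auto
  also have "\<dots> \<le> (\<Sum>s\<in>{1..d}. exp (- 5) / real d ^ 5)"
    by (intro prob_UN_le fixed_size) auto
  also have "\<dots> = exp (- 5) / real d ^ 4" using d by (simp add: field_simps eval_nat_numeral)
  also have "\<dots> \<le> 1 / real d ^ 4" by (intro divide_right_mono) auto
  also have "\<dots> \<le> 1 / (2 * real d ^ 3)" using d by (simp add: field_simps eval_nat_numeral)
  finally show ?thesis .
qed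

text \<open>For a fixed \<open>y\<close>, a Bernstein bound at level \<open>1 / d ^ 6\<close> for
  each row and sign, followed by a union over these \<open>2 * d\<close> cases. It is meant for
  \<open>y = Fs\<close>.\<close>

lemma prob_row_deviation_le:
  assumes d: "2 \<le> d" and y: "\<And>j. j < d \<Longrightarrow> \<bar>y j\<bar> \<le> 1"
    and e: "84 * ln (real d) \<le> e" and var: "48 * p * (\<Sum>j<d. (y j)\<^sup>2) * ln (real d) \<le> e\<^sup>2"
  shows "measure_pmf.prob law {X. \<exists>i\<in>{..<d}. e < \<bar>\<Sum>j<d. noise X i j * y j\<bar>} \<le> 1 / (2 * real d ^ 3)"
proof -
  define k where "k = (\<Sum>j<d. (y j)\<^sup>2)"
  have k: "0 \<le> k" unfolding k_def by (intro sum_nonneg) auto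
  have ln0: "0 < ln (real d)" using d by simp
  have e0: "0 < e" using e ln0 by linarith
  \<comment> \<open>The two Bernstein regimes: the cap \<open>1/2\<close>, or the optimiser
    \<open>e / (4 * p * k)\<close>. The latter gives the rate
    \<open>e\<^sup>2 / (8 * p * k)\<close>, so 48 in \<open>var\<close> is
    \<open>6 * 8\<close>.\<close>
  obtain \<theta> where \<theta>: "0 \<le> \<theta>" "\<theta> \<le> 1/2" "4 * p * k * \<theta> \<le> e" "6 * ln (real d) \<le> \<theta> * e / 2"
  proof (cases "2 * p * k \<le> e")
    case True
    then show ?thesis using e ln0 by (intro that[of "1/2"]) (auto simp: mult_ac)
  next
    case False
    then have pk: "0 < p * k" using e0 by simp
    show ?thesis
    proof (rule that[of "e / (4 * p * k)"])
      have "6 * ln (real d) * (8 * (p * k)) \<le> e * e"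
        using var by (simp add: k_def power2_eq_square mult_ac)
      then have "6 * ln (real d) \<le> e * e / (8 * (p * k))" using pk by (subst pos_le_divide_eq) auto
      then show "6 * ln (real d) \<le> e / (4 * p * k) * e / 2" by (simp add: mult.assoc)
    qed (use False pk e0 in \<open>auto simp: field_simps\<close>)
  qed
  have single: "measure_pmf.prob law {X. e < c * (\<Sum>j<d. noise X i j * y j)} \<le> 1 / real d ^ 6"
    if i: "i < d" and c: "\<bar>c\<bar> = 1" for i c
  proof -
    define x where "x j = (if j = i then c else 0)" for j
    have c2: "c\<^sup>2 = 1" using c by (metis one_power2 power2_abs)
    have "(\<Sum>j<d. (x j)\<^sup>2) = 1" using i by (simp add: x_def if_distrib[of "\<lambda>a. a\<^sup>2"] c2 cong: if_cong)
    moreover have "noise_form X x y = c * (\<Sum>j<d. noise X i j * y j)" for X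
      using i by (simp add: noise_form_row x_def if_distrib[of "\<lambda>a. a * _"] cong: if_cong)
    ultimately have "measure_pmf.prob law {X. e < c * (\<Sum>j<d. noise X i j * y j)} \<le> exp (- (\<theta> * e / 2))"
      using noise_form_tail[of e \<theta> x y] e0 \<theta> c y by (simp add: x_def k_def)
    also have "\<dots> \<le> exp (- (6 * ln (real d)))" using \<theta>(4) by simp
    also have "\<dots> = 1 / exp (ln (real d)) ^ 6"
      by (simp add: exp_minus divide_inverse flip: exp_of_nat_mult)
    finally show ?thesis using d by simp
  qed
  have "measure_pmf.prob law {X. \<exists>i\<in>{..<d}. e < \<bar>\<Sum>j<d. noise X i j * y j\<bar>}
     \<le> measure_pmf.prob law {X. \<exists>(i, c)\<in>{..<d} \<times> {1, -1}. e < c * (\<Sum>j<d. noise X i j * y j)}"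
    by (intro measure_pmf.finite_measure_mono) (auto simp: abs_if split: if_splits)
  also have "\<dots> = measure_pmf.prob law {X. \<exists>z\<in>{..<d} \<times> {1, -1}. e < snd z * (\<Sum>j<d. noise X (fst z) j * y j)}"
    by (simp add: case_prod_unfold)
  also have "\<dots> \<le> (\<Sum>z\<in>{..<d} \<times> {1, -1 :: real}. 1 / real d ^ 6)"
    by (intro prob_UN_le single) auto
  also have "\<dots> = 2 / real d ^ 5" using d by (simp add: field_simps eval_nat_numeral)
  also have "\<dots> \<le> 1 / (2 * real d ^ 3)"
  proof -
    have "2 * 2 \<le> real d * real d" using d by (intro mult_mono) auto
    then have "4 * real d ^ 3 \<le> real d ^ 5"
      by (simp add: eval_nat_numeral mult.assoc[symmetric] mult_right_mono)
    then show ?thesis using d by (simp add: field_simps)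
  qed
  finally show ?thesis .
qed

end

subsection \<open>Projection onto the feasible set\<close>

lemma l2norm_sq: "(l2norm x)\<^sup>2 = (\<Sum>i<dim_vec x. (x $ i)\<^sup>2)"
  by (simp add: l2norm_def scalar_prod_def atLeast0LessThan power2_eq_square sum_nonneg)

lemma l2norm_nonneg: "0 \<le> l2norm x"
  by (simp add: l2norm_def scalar_prod_def sum_nonneg)

lemma l2norm_le_iff: "l2norm x \<le> l2norm y \<longleftrightarrow> (l2norm x)\<^sup>2 \<le> (l2norm y)\<^sup>2"
  by (simp add: l2norm_nonneg)

lemma l2norm_diff_sq:
  assumes "x \<in> carrier_vec d" "y \<in> carrier_vec d"
  shows "(l2norm (x - y))\<^sup>2 = (\<Sum>i<d. (x $ i - y $ i)\<^sup>2)"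
  using assms by (simp add: l2norm_sq)

text \<open>Compactness comes from a product of compact sets in
  \<open>nat \<Rightarrow> real\<close>, with coordinates from \<open>d\<close> on pinned to 0, cut
  by a closed hyperplane.\<close>

lemma feasible_nearest_point_ex:
  assumes "feasible d k \<noteq> {}" "x \<in> carrier_vec d"
  shows "\<exists>y. is_arg_min (\<lambda>y. l2norm (x - y)) (\<lambda>y. y \<in> feasible d k) y"
proof -
  define B :: "nat \<Rightarrow> real set" where "B i = (if i < d then {0..1} else {0})" for i
  define K where "K = PiE UNIV B \<inter> {f. (\<Sum>i<d. f i) = real k}"
  define g where "g f = (\<Sum>i<d. (x $ i - f i)\<^sup>2)" for f :: "nat \<Rightarrow> real"
  have "compactin (product_topology (\<lambda>_. euclidean) UNIV) (PiE UNIV B)"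
    unfolding compactin_PiE by (auto simp: B_def)
  then have "compact (PiE UNIV B)"
    by (simp add: euclidean_product_topology)
  moreover have cont: "continuous_on UNIV (\<lambda>f :: nat \<Rightarrow> real. f i)" for i
    by simp
  have "closed {f :: nat \<Rightarrow> real. (\<Sum>i<d. f i) = real k}"
    by (intro closed_Collect_eq continuous_on_sum cont continuous_on_const)
  ultimately have "compact K" unfolding K_def by (intro compact_Int_closed)
  moreover have in_K: "(\<lambda>i. if i < d then y $ i else 0) \<in> K" if "y \<in> feasible d k" for y
    using that by (auto simp: K_def B_def feasible_def)
  then have "K \<noteq> {}" using assms(1) by blast
  moreover have "continuous_on K g"
    unfolding g_def
    by (intro continuous_intros continuous_on_subset[OF cont]) auto
  ultimately obtain f where f: "f \<in> K" "\<And>h. h \<in> K \<Longrightarrow> g f \<le> g h"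
    using continuous_attains_inf by metis
  have f_feas: "vec d f \<in> feasible d k"
    using f(1) by (auto simp: K_def B_def feasible_def PiE_iff split: if_splits)
  moreover have "l2norm (x - vec d f) \<le> l2norm (x - y)" if "y \<in> feasible d k" for y
  proof -
    have "y \<in> carrier_vec d" using that by (simp add: feasible_def)
    then show ?thesis
      using f(2)[OF in_K[OF that]] assms(2)
      unfolding l2norm_le_iff by (simp add: l2norm_diff_sq g_def)
  qed
  ultimately show ?thesis
    by (auto simp: is_arg_min_linorder)
qed

lemma proj_feasible:
  assumes "feasible d k \<noteq> {}" "x \<in> carrier_vec d"
  shows "proj (feasible d k) x \<in> feasible d k"
    and "y \<in> feasible d k \<Longrightarrow> l2norm (x - proj (feasible d k) x) \<le> l2norm (x - y)"
proof -
  have "is_arg_min (\<lambda>y. l2norm (x - y)) (\<lambda>y. y \<in> feasible d k) (proj (feasible d k) x)"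
    unfolding proj_def arg_min_def using feasible_nearest_point_ex[OF assms] by (rule someI_ex)
  then show "proj (feasible d k) x \<in> feasible d k"
    "y \<in> feasible d k \<Longrightarrow> l2norm (x - proj (feasible d k) x) \<le> l2norm (x - y)"
    by (auto simp: is_arg_min_linorder)
qed

lemma feasible_convex:
  assumes "x \<in> feasible d k" "y \<in> feasible d k" "0 \<le> t" "t \<le> 1"
  shows "vec d (\<lambda>i. x $ i + t * (y $ i - x $ i)) \<in> feasible d k"
proof -
  have "0 \<le> x $ i + t * (y $ i - x $ i) \<and> x $ i + t * (y $ i - x $ i) \<le> 1" if "i < d" for i
  proof -
    have "x $ i + t * (y $ i - x $ i) = (1 - t) * x $ i + t * y $ i" by (simp add: algebra_simps)
    moreover have "0 \<le> (1 - t) * x $ i + t * y $ i"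
      using assms that by (intro add_nonneg_nonneg mult_nonneg_nonneg) (auto simp: feasible_def)
    moreover have "(1 - t) * x $ i + t * y $ i \<le> 1"
      using assms that by (intro convex_bound_le) (auto simp: feasible_def)
    ultimately show ?thesis by simp
  qed
  moreover have "(\<Sum>i<d. x $ i + t * (y $ i - x $ i)) = real k"
    using assms by (simp add: sum.distrib sum_subtractf feasible_def flip: sum_distrib_left)
  ultimately show ?thesis by (simp add: feasible_def)
qed

text \<open>The obtuse angle criterion: moving from \<open>P\<close> towards \<open>y\<close> by
  \<open>t\<close> changes the squared distance by \<open>t\<^sup>2 * Q - 2 * t * A\<close>, and
  optimality of \<open>P\<close> forbids a decrease at small \<open>t\<close>.\<close>

lemma proj_feasible_variational:
  assumes x: "x \<in> carrier_vec d" and y: "y \<in> feasible d k"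
  defines "P \<equiv> proj (feasible d k) x"
  shows "(\<Sum>i<d. (x $ i - P $ i) * (y $ i - P $ i)) \<le> 0"
proof (rule ccontr)
  define A where "A = (\<Sum>i<d. (x $ i - P $ i) * (y $ i - P $ i))"
  define Q where "Q = (\<Sum>i<d. (y $ i - P $ i)\<^sup>2)"
  assume "\<not> ?thesis"
  then have A: "0 < A" by (simp add: A_def)
  have ne: "feasible d k \<noteq> {}" using y by blast
  have P: "P \<in> feasible d k" unfolding P_def by (rule proj_feasible(1)[OF ne x])
  have Q: "0 \<le> Q" unfolding Q_def by (intro sum_nonneg) simp
  have le: "2 * A \<le> t * Q" if t: "0 < t" "t \<le> 1" for t
  proof -
    let ?z = "vec d (\<lambda>i. P $ i + t * (y $ i - P $ i))"
    have "l2norm (x - P) \<le> l2norm (x - ?z)"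
      unfolding P_def by (rule proj_feasible(2)[OF ne x])
        (use feasible_convex[OF P y] t in \<open>auto simp: P_def\<close>)
    moreover have "P \<in> carrier_vec d" using P by (simp add: feasible_def)
    ultimately have "(\<Sum>i<d. (x $ i - P $ i)\<^sup>2) \<le> (\<Sum>i<d. (x $ i - (P $ i + t * (y $ i - P $ i)))\<^sup>2)"
      unfolding l2norm_le_iff using x by (simp add: l2norm_diff_sq)
    also have "\<dots> = (\<Sum>i<d. (x $ i - P $ i)\<^sup>2 - 2 * t * ((x $ i - P $ i) * (y $ i - P $ i))
        + t\<^sup>2 * (y $ i - P $ i)\<^sup>2)"
      by (intro sum.cong refl) (simp add: power2_eq_square algebra_simps)
    also have "\<dots> = (\<Sum>i<d. (x $ i - P $ i)\<^sup>2) - 2 * t * A + t\<^sup>2 * Q"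
      by (simp add: A_def Q_def sum.distrib sum_subtractf sum_distrib_left)
    finally have "t * (2 * A) \<le> t * (t * Q)" by (simp add: power2_eq_square algebra_simps)
    then show ?thesis using t by simp
  qed
  \<comment> \<open>Ensures \<open>t * Q \<le> A\<close>; the \<open>+ 1\<close> covers
    \<open>Q = 0\<close>.\<close>
  define t where "t = min 1 (A / (Q + 1))"
  have "0 < t" "t \<le> 1" using A Q by (auto simp: t_def)
  moreover have "t * Q \<le> A / (Q + 1) * Q" using Q by (intro mult_right_mono) (auto simp: t_def)
  moreover have "A / (Q + 1) * Q \<le> A" using A Q by (simp add: field_simps)
  ultimately show False using le[of t] A by linarith
qed

subsection \<open>Contraction of the projected gradient step\<close>

lemma cluster_support:
  assumes "Fs \<in> cluster_vectors d k"
  defines "C \<equiv> {i. i < d \<and> Fs $ i = 1}"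
  shows "Fs \<in> carrier_vec d" "C \<subseteq> {..<d}" "finite C" "card C = k"
    and "i < d \<Longrightarrow> Fs $ i = indicator C i"
proof -
  show "Fs \<in> carrier_vec d" "C \<subseteq> {..<d}" "card C = k" "finite C"
    using assms by (auto simp: cluster_vectors_def)
  show "i < d \<Longrightarrow> Fs $ i = indicator C i"
    using assms by (force simp: cluster_vectors_def C_def)
qed

lemma cluster_vector_feasible:
  assumes "Fs \<in> cluster_vectors d k"
  shows "Fs \<in> feasible d k"
proof -
  note C = cluster_support[OF assms]
  have "(\<Sum>i<d. Fs $ i) = (\<Sum>i<d. indicator {i. i < d \<and> Fs $ i = 1} i)"
    by (intro sum.cong refl C(5)) auto
  also have "\<dots> = (\<Sum>i\<in>{i. i < d \<and> Fs $ i = 1}. 1)"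
    using C(2) by (intro sum.mono_neutral_cong_right) auto
  finally have "(\<Sum>i<d. Fs $ i) = real k" using C(4) by simp
  moreover have "0 \<le> Fs $ i \<and> Fs $ i \<le> 1" if "i < d" for i
    using C(5)[OF that] by (metis indicator_pos_le indicator_le_1)
  ultimately show ?thesis using C(1) by (simp add: feasible_def)
qed

text \<open>Coordinates are nonnegative, so \<open>F - G\<close> is never longer than
  \<open>F + G\<close> and the sign ambiguity disappears.\<close>

lemma sign_dist_feasible:
  assumes F: "F \<in> feasible d k" and G: "G \<in> feasible d k"
  shows "(sign_dist F G)\<^sup>2 = (\<Sum>i<d. (F $ i - G $ i)\<^sup>2)"
proof -
  have carr: "F \<in> carrier_vec d" "G \<in> carrier_vec d" using assms by (auto simp: feasible_def)
  have "(\<Sum>i<d. (F $ i - G $ i)\<^sup>2) \<le> (\<Sum>i<d. (F $ i + G $ i)\<^sup>2)"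
    using F G by (intro sum_mono) (auto simp: feasible_def power2_eq_square algebra_simps)
  then have "l2norm (F - G) \<le> l2norm (F + G)"
    unfolding l2norm_le_iff using carr by (simp add: l2norm_sq)
  then show ?thesis using carr by (simp add: sign_dist_def l2norm_diff_sq)
qed

text \<open>Maximising over the coordinates of \<open>v\<close> first reduces the hypothesis on index sets to the two
  sets on which the linear form \<open>Y\<close> exceeds \<open>e\<close> in absolute value.\<close>

lemma bilinear_bound_from_sets:
  fixes W :: "nat \<Rightarrow> nat \<Rightarrow> real"
  assumes R: "\<And>T w. T \<subseteq> {..<d} \<Longrightarrow> (\<And>i. i < d \<Longrightarrow> \<bar>w i\<bar> \<le> 1) \<Longrightarrow>
      (\<Sum>i<d. w i * (\<Sum>j\<in>T. W i j)) \<le> e * (real (card T) + (\<Sum>i<d. (w i)\<^sup>2))"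
    and u: "\<And>i. i < d \<Longrightarrow> \<bar>u i\<bar> \<le> 1" and v: "\<And>i. i < d \<Longrightarrow> \<bar>v i\<bar> \<le> 1"
  shows "(\<Sum>i<d. u i * (\<Sum>j<d. W i j * v j)) \<le> e * ((\<Sum>j<d. \<bar>v j\<bar>) + 2 * (\<Sum>i<d. (u i)\<^sup>2))"
proof -
  define Y where "Y j = (\<Sum>i<d. u i * W i j)" for j
  define Tp where "Tp = {j. j < d \<and> e < Y j}"
  define Tm where "Tm = {j. j < d \<and> e < - Y j}"
  have T: "finite Tp" "finite Tm" "Tp \<subseteq> {..<d}" "Tm \<subseteq> {..<d}" by (auto simp: Tp_def Tm_def)
  have swap: "(\<Sum>i<d. w i * (\<Sum>j\<in>T. W i j)) = (\<Sum>j\<in>T. \<Sum>i<d. w i * W i j)" for w T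
    by (subst sum.swap) (simp add: sum_distrib_left)
  have p: "(\<Sum>j\<in>Tp. Y j - e) \<le> e * (\<Sum>i<d. (u i)\<^sup>2)"
    using R[OF T(3), of u] u unfolding swap by (simp add: Y_def sum_subtractf algebra_simps)
  \<comment> \<open>The negative side is the same hypothesis applied to \<open>- u\<close>.\<close>
  have m: "(\<Sum>j\<in>Tm. - Y j - e) \<le> e * (\<Sum>i<d. (u i)\<^sup>2)"
    using R[OF T(4), of "\<lambda>i. - u i"] u unfolding swap
    by (simp add: Y_def sum_subtractf sum_negf algebra_simps)
  have "(\<Sum>i<d. u i * (\<Sum>j<d. W i j * v j)) - e * (\<Sum>j<d. \<bar>v j\<bar>) = (\<Sum>j<d. Y j * v j - e * \<bar>v j\<bar>)"
  proof -
    have "(\<Sum>i<d. u i * (\<Sum>j<d. W i j * v j)) = (\<Sum>i<d. \<Sum>j<d. u i * W i j * v j)"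
      by (simp add: sum_distrib_left mult.assoc)
    also have "\<dots> = (\<Sum>j<d. Y j * v j)"
      by (subst sum.swap) (simp add: Y_def sum_distrib_right)
    finally show ?thesis by (simp add: sum_subtractf sum_distrib_left)
  qed
  also have "\<dots> \<le> (\<Sum>j<d. (if j \<in> Tp then Y j - e else 0) + (if j \<in> Tm then - Y j - e else 0))"
  proof (rule sum_mono)
    fix j assume "j \<in> {..<d}"
    then have j: "j < d" by simp
    have "Y j * v j \<le> \<bar>Y j\<bar> * \<bar>v j\<bar>" by (metis abs_ge_self abs_mult)
    then have "Y j * v j - e * \<bar>v j\<bar> \<le> (\<bar>Y j\<bar> - e) * \<bar>v j\<bar>" by (simp add: algebra_simps)
    also have "\<dots> \<le> max 0 (\<bar>Y j\<bar> - e) * \<bar>v j\<bar>" by (intro mult_right_mono) auto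
    also have "\<dots> \<le> max 0 (\<bar>Y j\<bar> - e) * 1" by (intro mult_left_mono v j) auto
    also have "\<dots> \<le> (if j \<in> Tp then Y j - e else 0) + (if j \<in> Tm then - Y j - e else 0)"
      using j by (auto simp: Tp_def Tm_def abs_if max_def)
    finally show "Y j * v j - e * \<bar>v j\<bar> \<le> (if j \<in> Tp then Y j - e else 0) + (if j \<in> Tm then - Y j - e else 0)" .
  qed
  also have "\<dots> = (\<Sum>j\<in>Tp. Y j - e) + (\<Sum>j\<in>Tm. - Y j - e)"
    using T by (simp add: sum.distrib sum.If_cases Int_absorb1)
  finally show ?thesis using p m by (simp add: algebra_simps)
qed

text \<open>\<open>a\<close> is the mass that \<open>F\<close> lacks on the cluster. Both total
  masses are \<open>k\<close>, so the same amount sits outside, and \<open>a\<close> is half of the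
  1-norm of the error.\<close>

lemma cluster_deviation_facts:
  assumes Fs: "Fs \<in> cluster_vectors d k" and F: "F \<in> feasible d k"
  defines "C \<equiv> {i. i < d \<and> Fs $ i = 1}" and "a \<equiv> real k - (\<Sum>i\<in>{i. i < d \<and> Fs $ i = 1}. F $ i)"
  shows "(\<Sum>i<d. \<bar>F $ i - Fs $ i\<bar>) = 2 * a" "(\<Sum>i\<in>C. F $ i - Fs $ i) = - a"
    "(\<Sum>i\<in>C. \<bar>F $ i - Fs $ i\<bar>) = a" "0 \<le> a" "(\<Sum>i<d. F $ i - Fs $ i) = 0"
    "(\<Sum>i<d. (F $ i - Fs $ i)\<^sup>2) \<le> 2 * a" "i < d \<Longrightarrow> \<bar>F $ i - Fs $ i\<bar> \<le> 1"
proof -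
  note C = cluster_support[OF Fs, folded C_def]
  have Fs1: "Fs $ i = 1" if "i \<in> C" for i using that by (simp add: C_def)
  have Fs0: "Fs $ i = 0" if "i \<in> {..<d} - C" for i using that C(5) by auto
  have Fb: "0 \<le> F $ i" "F $ i \<le> 1" if "i < d" for i using F that by (auto simp: feasible_def)
  have sumF: "(\<Sum>i<d. F $ i) = real k" using F by (simp add: feasible_def)
  show in1: "(\<Sum>i\<in>C. F $ i - Fs $ i) = - a"
    using C(4) by (simp add: sum_subtractf Fs1 a_def C_def[symmetric])
  have "(\<Sum>i\<in>C. \<bar>F $ i - Fs $ i\<bar>) = (\<Sum>i\<in>C. - (F $ i - Fs $ i))"
    using Fb C(2) by (intro sum.cong) (auto simp: Fs1)
  then show in2: "(\<Sum>i\<in>C. \<bar>F $ i - Fs $ i\<bar>) = a"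
    using in1 by (simp add: sum_negf del: minus_diff_eq)
  then show "0 \<le> a" using sum_nonneg[of C "\<lambda>i. \<bar>F $ i - Fs $ i\<bar>"] by simp
  have split: "(\<Sum>i<d. f i) = (\<Sum>i\<in>{..<d} - C. f i) + (\<Sum>i\<in>C. f i)" for f :: "nat \<Rightarrow> real"
    using C(2) by (intro sum.subset_diff) auto
  have "(\<Sum>i\<in>{..<d} - C. \<bar>F $ i - Fs $ i\<bar>) = (\<Sum>i\<in>{..<d} - C. F $ i)"
    using Fb by (intro sum.cong) (auto simp: Fs0)
  also have "\<dots> = a" using split[of "\<lambda>i. F $ i"] sumF by (simp add: a_def C_def)
  finally show abs: "(\<Sum>i<d. \<bar>F $ i - Fs $ i\<bar>) = 2 * a" using split in2 by simp
  show "(\<Sum>i<d. F $ i - Fs $ i) = 0"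
    using sumF cluster_vector_feasible[OF Fs] by (simp add: sum_subtractf feasible_def)
  show le1: "\<bar>F $ i - Fs $ i\<bar> \<le> 1" if "i < d" for i
    using Fb[OF that] C(5)[OF that] by (auto simp: indicator_def)
  have "(\<Sum>i<d. (F $ i - Fs $ i)\<^sup>2) \<le> (\<Sum>i<d. \<bar>F $ i - Fs $ i\<bar>)"
  proof (rule sum_mono)
    fix i assume "i \<in> {..<d}"
    then have "\<bar>F $ i - Fs $ i\<bar> * \<bar>F $ i - Fs $ i\<bar> \<le> \<bar>F $ i - Fs $ i\<bar> * 1"
      using le1 by (intro mult_left_mono) auto
    then show "(F $ i - Fs $ i)\<^sup>2 \<le> \<bar>F $ i - Fs $ i\<bar>" by (simp add: power2_eq_square)
  qed
  then show "(\<Sum>i<d. (F $ i - Fs $ i)\<^sup>2) \<le> 2 * a" using abs by simp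
qed

text \<open>The noise adds at most \<open>M * (a' / 5 + U / 10)\<close> and the signal removes at
  least \<open>4/5 * M * a'\<close>. Hence \<open>V \<le> 7/5 * U - 12/5 * a'\<close>, and
  \<open>V \<le> 2 * a'\<close> turns this into the contraction.\<close>

lemma projected_gradient_step:
  fixes W :: "nat \<Rightarrow> nat \<Rightarrow> real" and d k :: nat and \<delta> :: real
  assumes Fs: "Fs \<in> cluster_vectors d k" and k: "1 \<le> k" and \<delta>: "0 < \<delta>"
    and S: "S \<in> carrier_mat d d"
    and S_entry: "\<And>i j. i < d \<Longrightarrow> j < d \<Longrightarrow> S $$ (i, j) = W i j + \<delta> * (Fs $ i * Fs $ j) - \<delta> / 2"
    and W_sym: "\<And>i j. W i j = W j i"
    and R: "\<And>T w. T \<subseteq> {..<d} \<Longrightarrow> (\<And>i. i < d \<Longrightarrow> \<bar>w i\<bar> \<le> 1) \<Longrightarrow>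
      (\<Sum>i<d. w i * (\<Sum>j\<in>T. W i j)) \<le> \<delta> * real k / 20 * (real (card T) + (\<Sum>i<d. (w i)\<^sup>2))"
    and R0: "\<And>i. i < d \<Longrightarrow> \<bar>\<Sum>j<d. W i j * Fs $ j\<bar> \<le> \<delta> * real k / 20"
    and F: "F \<in> feasible d k" and near: "(\<Sum>i<d. (F $ i - Fs $ i)\<^sup>2) \<le> real k / 25"
  defines "F' \<equiv> proj (feasible d k) (F - (1 / (\<delta> * real k)) \<cdot>\<^sub>v gradient (loss S) F)"
  shows "F' \<in> feasible d k" "22 * (\<Sum>i<d. (F' $ i - Fs $ i)\<^sup>2) \<le> 14 * (\<Sum>i<d. (F $ i - Fs $ i)\<^sup>2)"
proof -
  define M where "M = \<delta> * real k"
  define C where "C = {i. i < d \<and> Fs $ i = 1}"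
  note C = cluster_support[OF Fs, folded C_def]
  have M: "0 < M" using k \<delta> by (simp add: M_def)
  define x where "x = F - (1 / (\<delta> * real k)) \<cdot>\<^sub>v gradient (loss S) F"
  define u where "u i = F $ i - Fs $ i" for i
  define v where "v i = F' $ i - Fs $ i" for i
  define G where "G i = (\<Sum>j<d. S $$ (i, j) * F $ j)" for i
  have Fc: "F \<in> carrier_vec d" using F by (simp add: feasible_def)
  have S_sym: "transpose_mat S = S"
  proof (rule eq_matI)
    fix i j assume "i < dim_row S" "j < dim_col S"
    then show "transpose_mat S $$ (i, j) = S $$ (i, j)"
      using S W_sym[of i j] by (simp add: S_entry mult.commute)
  qed (use S in auto)
  have grad: "gradient (loss S) F = (-2) \<cdot>\<^sub>v (S *\<^sub>v F)"
    by (rule gradient_loss[OF S S_sym Fc])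
  have x: "x \<in> carrier_vec d" using S Fc by (simp add: x_def grad)
  define c where "c = 2 / M"
  have x_entry: "x $ i = F $ i + c * G i" if "i < d" for i
    using that S Fc by (simp add: x_def grad c_def M_def G_def scalar_prod_def atLeast0LessThan)
  note Fs_feas = cluster_vector_feasible[OF Fs]
  have ne: "feasible d k \<noteq> {}" using F by blast
  show F': "F' \<in> feasible d k" unfolding F'_def x_def[symmetric] by (rule proj_feasible(1)[OF ne x])
  define a where "a = real k - (\<Sum>i\<in>C. F $ i)"
  define a' where "a' = real k - (\<Sum>i\<in>C. F' $ i)"
  note au = cluster_deviation_facts[OF Fs F, folded C_def, folded a_def u_def]
  note av = cluster_deviation_facts[OF Fs F', folded C_def, folded a'_def v_def]
  define U where "U = (\<Sum>i<d. (u i)\<^sup>2)"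
  define V where "V = (\<Sum>i<d. (v i)\<^sup>2)"
  have "(\<Sum>i<d. (x $ i - F' $ i) * (Fs $ i - F' $ i)) \<le> 0"
    unfolding F'_def x_def[symmetric] by (rule proj_feasible_variational[OF x Fs_feas])
  \<comment> \<open>Polarisation of \<open>u i * v i\<close>; the resulting square
    \<open>(u i - v i)\<^sup>2\<close> is discarded in \<open>VU\<close>.\<close>
  also have "(\<Sum>i<d. (x $ i - F' $ i) * (Fs $ i - F' $ i))
      = (\<Sum>i<d. (v i)\<^sup>2 / 2 - (u i)\<^sup>2 / 2 + (u i - v i)\<^sup>2 / 2 - c * (G i * v i))"
    by (intro sum.cong refl) (simp add: x_entry u_def v_def power2_eq_square algebra_simps add_divide_distrib diff_divide_distrib)
  also have "\<dots> = V / 2 - U / 2 + (\<Sum>i<d. (u i - v i)\<^sup>2) / 2 - c * (\<Sum>i<d. G i * v i)"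
    by (simp add: U_def V_def sum.distrib sum_subtractf sum_distrib_left sum_divide_distrib)
  finally have VU: "V \<le> U + 4 / M * (\<Sum>i<d. G i * v i)"
    using sum_nonneg[of "{..<d}" "\<lambda>i. (u i - v i)\<^sup>2"] by (simp add: c_def)
  have FsF: "(\<Sum>j<d. Fs $ j * F $ j) = real k - a"
  proof -
    have "(\<Sum>j<d. Fs $ j * F $ j) = (\<Sum>j\<in>C. F $ j)"
      using C by (intro sum.mono_neutral_cong_right) (auto simp: indicator_def)
    then show ?thesis by (simp add: a_def)
  qed
  have Fsv: "(\<Sum>i<d. Fs $ i * v i) = - a'"
  proof -
    have "(\<Sum>j<d. Fs $ j * v j) = (\<Sum>j\<in>C. v j)"
      using C by (intro sum.mono_neutral_cong_right) (auto simp: indicator_def)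
    then show ?thesis using av(2) by simp
  qed
  \<comment> \<open>The term \<open>M / 2\<close> is the all-ones part of \<open>S\<close>; it drops
    out below because \<open>v\<close> sums to 0.\<close>
  have G: "G i = (\<Sum>j<d. W i j * Fs $ j) + (\<Sum>j<d. W i j * u j) + \<delta> * (real k - a) * Fs $ i - M / 2"
    if "i < d" for i
  proof -
    have "G i = (\<Sum>j<d. W i j * Fs $ j + W i j * u j + \<delta> * Fs $ i * (Fs $ j * F $ j) - \<delta> / 2 * F $ j)"
      unfolding G_def using that by (intro sum.cong refl) (simp add: S_entry u_def algebra_simps)
    also have "\<dots> = (\<Sum>j<d. W i j * Fs $ j) + (\<Sum>j<d. W i j * u j) + \<delta> * Fs $ i * (\<Sum>j<d. Fs $ j * F $ j)
        - \<delta> / 2 * (\<Sum>j<d. F $ j)"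
      by (simp add: sum.distrib sum_subtractf sum_distrib_left)
    finally show ?thesis using F unfolding FsF by (simp add: M_def feasible_def mult_ac)
  qed
  have "(\<Sum>i<d. G i * v i) = (\<Sum>i<d. v i * (\<Sum>j<d. W i j * Fs $ j) + v i * (\<Sum>j<d. W i j * u j)
      + \<delta> * (real k - a) * (Fs $ i * v i) - M / 2 * v i)"
    by (intro sum.cong refl) (simp add: G algebra_simps)
  also have "\<dots> = (\<Sum>i<d. v i * (\<Sum>j<d. W i j * Fs $ j)) + (\<Sum>i<d. v i * (\<Sum>j<d. W i j * u j))
      + \<delta> * (real k - a) * (\<Sum>i<d. Fs $ i * v i) - M / 2 * (\<Sum>i<d. v i)"
    by (simp only: sum.distrib sum_subtractf sum_distrib_left)
  also have "\<dots> = (\<Sum>i<d. v i * (\<Sum>j<d. W i j * Fs $ j)) + (\<Sum>i<d. v i * (\<Sum>j<d. W i j * u j))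
      - \<delta> * (real k - a) * a'"
    using av(5) by (simp add: Fsv)
  finally have GV: "(\<Sum>i<d. G i * v i) = \<dots>" .
  have t1: "(\<Sum>i<d. v i * (\<Sum>j<d. W i j * Fs $ j)) \<le> M / 20 * (2 * a')"
  proof -
    have "(\<Sum>i<d. v i * (\<Sum>j<d. W i j * Fs $ j)) \<le> (\<Sum>i<d. M / 20 * \<bar>v i\<bar>)"
    proof (rule sum_mono)
      fix i assume "i \<in> {..<d}"
      then have "\<bar>v i\<bar> * \<bar>\<Sum>j<d. W i j * Fs $ j\<bar> \<le> \<bar>v i\<bar> * (M / 20)"
        using R0 by (intro mult_left_mono) (auto simp: M_def)
      moreover have "v i * (\<Sum>j<d. W i j * Fs $ j) \<le> \<bar>v i\<bar> * \<bar>\<Sum>j<d. W i j * Fs $ j\<bar>"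
        by (metis abs_ge_self abs_mult)
      ultimately show "v i * (\<Sum>j<d. W i j * Fs $ j) \<le> M / 20 * \<bar>v i\<bar>"
        by (simp add: mult.commute)
    qed
    then show ?thesis using av(1) by (simp only: sum_distrib_left[symmetric])
  qed
  have t2: "(\<Sum>i<d. v i * (\<Sum>j<d. W i j * u j)) \<le> M / 20 * (2 * a' + 2 * U)"
  proof -
    have "(\<Sum>i<d. v i * (\<Sum>j<d. W i j * u j)) = (\<Sum>i<d. \<Sum>j<d. W i j * v i * u j)"
      by (simp add: sum_distrib_left mult_ac)
    \<comment> \<open>Symmetry exchanges the roles, so that \<open>v\<close> is measured by its
      1-norm and \<open>u\<close> by its squared norm.\<close>
    also have "\<dots> = (\<Sum>j<d. \<Sum>i<d. W j i * v i * u j)"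
      by (subst sum.swap, intro sum.cong refl) (metis W_sym)
    also have "\<dots> = (\<Sum>i<d. u i * (\<Sum>j<d. W i j * v j))"
      by (simp add: sum_distrib_left mult_ac)
    also have "\<dots> \<le> M / 20 * ((\<Sum>j<d. \<bar>v j\<bar>) + 2 * (\<Sum>i<d. (u i)\<^sup>2))"
      unfolding M_def by (rule bilinear_bound_from_sets[OF R]) (auto simp: au(7) av(7))
    finally show ?thesis using av(1) by (simp add: U_def)
  qed
  \<comment> \<open>Cauchy-Schwarz on the \<open>k\<close> cluster coordinates; here the radius
    \<open>1/5 * sqrt k\<close> enters.\<close>
  have a: "a \<le> real k / 5"
  proof -
    have "a\<^sup>2 = (\<Sum>i\<in>C. 1 * \<bar>u i\<bar>)\<^sup>2" using au(3) by simp
    also have "\<dots> \<le> (\<Sum>i\<in>C. 1\<^sup>2) * (\<Sum>i\<in>C. \<bar>u i\<bar>\<^sup>2)" by (rule Cauchy_Schwarz_ineq_sum)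
    also have "\<dots> \<le> real k * (real k / 25)"
    proof (intro mult_mono)
      have "(\<Sum>i\<in>C. \<bar>u i\<bar>\<^sup>2) \<le> (\<Sum>i<d. (u i)\<^sup>2)"
        using C(2) by (simp add: sum_mono2)
      then show "(\<Sum>i\<in>C. \<bar>u i\<bar>\<^sup>2) \<le> real k / 25" using near by (simp add: u_def)
    qed (auto simp: C(4) sum_nonneg)
    finally have "a\<^sup>2 \<le> (real k / 5)\<^sup>2" by (simp add: power2_eq_square)
    then show ?thesis by (rule power2_le_imp_le) simp
  qed
  have "\<delta> * (4 / 5 * real k) * a' \<le> \<delta> * (real k - a) * a'"
    using a \<delta> av(4) by (intro mult_right_mono mult_left_mono) auto
  then have t3: "4 / 5 * M * a' \<le> \<delta> * (real k - a) * a'" by (simp add: M_def)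
  have "(\<Sum>i<d. G i * v i) \<le> M / 20 * (2 * a') + M / 20 * (2 * a' + 2 * U) - 4 / 5 * M * a'"
    using GV t1 t2 t3 by linarith
  also have "\<dots> = M * (U / 10 - 3 / 5 * a')" by (simp add: field_simps)
  finally have "4 / M * (\<Sum>i<d. G i * v i) \<le> 4 / M * (M * (U / 10 - 3 / 5 * a'))"
    using M by (intro mult_left_mono) auto
  also have "\<dots> = 4 * (U / 10 - 3 / 5 * a')" using M by simp
  finally have "V \<le> U + 4 * (U / 10 - 3 / 5 * a')" using VU by linarith
  then show "22 * (\<Sum>i<d. (F' $ i - Fs $ i)\<^sup>2) \<le> 14 * (\<Sum>i<d. (F $ i - Fs $ i)\<^sup>2)"
    using av(6) unfolding V_def[symmetric] U_def[symmetric] u_def[symmetric] v_def[symmetric] by simp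
qed

text \<open>Contraction keeps every iterate within the initial radius, so the one-step bound applies
  again. The ratio 14/22 is rounded up to 7/10.\<close>

lemma projected_gradient_iterates:
  fixes W :: "nat \<Rightarrow> nat \<Rightarrow> real" and d k :: nat and \<delta> :: real
  assumes Fs: "Fs \<in> cluster_vectors d k" and k: "1 \<le> k" and \<delta>: "0 < \<delta>"
    and S: "S \<in> carrier_mat d d"
    and S_entry: "\<And>i j. i < d \<Longrightarrow> j < d \<Longrightarrow> S $$ (i, j) = W i j + \<delta> * (Fs $ i * Fs $ j) - \<delta> / 2"
    and W_sym: "\<And>i j. W i j = W j i"
    and R: "\<And>T w. T \<subseteq> {..<d} \<Longrightarrow> (\<And>i. i < d \<Longrightarrow> \<bar>w i\<bar> \<le> 1) \<Longrightarrow>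
      (\<Sum>i<d. w i * (\<Sum>j\<in>T. W i j)) \<le> \<delta> * real k / 20 * (real (card T) + (\<Sum>i<d. (w i)\<^sup>2))"
    and R0: "\<And>i. i < d \<Longrightarrow> \<bar>\<Sum>j<d. W i j * Fs $ j\<bar> \<le> \<delta> * real k / 20"
    and F0: "F0 \<in> feasible d k" and near: "sign_dist F0 Fs \<le> 1/5 * sqrt (real k)"
  defines "F \<equiv> proj_grad_iter (feasible d k) (\<lambda>_. 1 / (\<delta> * real k)) (loss S) F0"
  shows "(sign_dist (F t) Fs)\<^sup>2 \<le> (7/10) ^ t * (sign_dist F0 Fs)\<^sup>2"
proof -
  have Fs': "Fs \<in> feasible d k" by (rule cluster_vector_feasible[OF Fs])
  note sd = sign_dist_feasible[OF _ Fs']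
  have "0 \<le> sign_dist F0 Fs" by (simp add: sign_dist_def l2norm_nonneg)
  then have "(sign_dist F0 Fs)\<^sup>2 \<le> (1/5 * sqrt (real k))\<^sup>2" using near by (intro power_mono)
  then have start: "(sign_dist F0 Fs)\<^sup>2 \<le> real k / 25" by (simp add: power_mult_distrib power_divide)
  have "F t \<in> feasible d k \<and> (sign_dist (F t) Fs)\<^sup>2 \<le> (7/10) ^ t * (sign_dist F0 Fs)\<^sup>2"
  proof (induction t)
    case 0
    then show ?case using F0 by (simp add: F_def)
  next
    case (Suc t)
    have step: "F (Suc t) = proj (feasible d k) (F t - (1 / (\<delta> * real k)) \<cdot>\<^sub>v gradient (loss S) (F t))"
      by (simp add: F_def Let_def)
    have "(7/10) ^ t * (sign_dist F0 Fs)\<^sup>2 \<le> 1 * (sign_dist F0 Fs)\<^sup>2"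
      by (intro mult_right_mono power_le_one) auto
    then have near_t: "(\<Sum>i<d. (F t $ i - Fs $ i)\<^sup>2) \<le> real k / 25"
      using Suc start sd[of "F t"] by simp
    note step_bound = projected_gradient_step[where Fs = Fs and W = W and F = "F t" and k = k and d = d
        and S = S and \<delta> = \<delta>, OF Fs k \<delta> S S_entry W_sym R R0 conjunct1[OF Suc] near_t]
    have F_Suc: "F (Suc t) \<in> feasible d k"
      unfolding step by (rule step_bound(1))
    have "22 * (\<Sum>i<d. (F (Suc t) $ i - Fs $ i)\<^sup>2) \<le> 14 * (\<Sum>i<d. (F t $ i - Fs $ i)\<^sup>2)"
      unfolding step by (rule step_bound(2))
    then have "22 * (sign_dist (F (Suc t)) Fs)\<^sup>2 \<le> 14 * (sign_dist (F t) Fs)\<^sup>2"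
      unfolding sd[OF F_Suc] sd[OF conjunct1[OF Suc]] .
    then have "(sign_dist (F (Suc t)) Fs)\<^sup>2 \<le> (7/10) * (sign_dist (F t) Fs)\<^sup>2"
      using zero_le_power2[of "sign_dist (F t) Fs"] by linarith
    also have "\<dots> \<le> (7/10) * ((7/10) ^ t * (sign_dist F0 Fs)\<^sup>2)"
      by (intro mult_left_mono conjunct2[OF Suc]) simp
    finally show ?case using F_Suc by (simp only: power_Suc mult.assoc)
  qed
  then show ?thesis ..
qed

section \<open>From the signal-to-noise condition to the probability estimate\<close>

text \<open>Multiplied by \<open>p * k\<^sup>2\<close>, the right side of \<open>snr\<close> is
  \<open>400 * e\<^sup>2\<close>. For the bound linear in \<open>e\<close>,
  \<open>p - q \<le> p\<close> gives \<open>20 * e \<le> p * k\<close>, and one factor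
  \<open>e\<close> cancels.\<close>

lemma planted_snr_bounds:
  fixes p q :: real and d k :: nat
  assumes d: "2 \<le> d" and k: "1 \<le> k" and q: "0 \<le> q" "q < p"
    and snr: "100000 * (ln (real d) / real k + real d / (real k)\<^sup>2) \<le> (p - q)\<^sup>2 / p"
  defines "e \<equiv> (p - q) * real k / 20"
  shows "84 * ln (real d) \<le> e" "224 * p * real d \<le> e\<^sup>2" "48 * p * real k * ln (real d) \<le> e\<^sup>2"
proof -
  have ln0: "0 \<le> ln (real d)" using d by simp
  have p: "0 < p" using q by simp
  have "p * (real k)\<^sup>2 * (100000 * (ln (real d) / real k + real d / (real k)\<^sup>2)) \<le> p * (real k)\<^sup>2 * ((p - q)\<^sup>2 / p)"
    using p by (intro mult_left_mono snr) auto
  also have "\<dots> = 400 * e\<^sup>2" using p by (simp add: e_def power2_eq_square field_simps)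
  also have "p * (real k)\<^sup>2 * (100000 * (ln (real d) / real k + real d / (real k)\<^sup>2))
      = 100000 * (p * real k * ln (real d)) + 100000 * (p * real d)"
    using k by (simp add: power2_eq_square field_simps)
  finally have main: "100000 * (p * real k * ln (real d)) + 100000 * (p * real d) \<le> 400 * e\<^sup>2" .
  have nonneg: "0 \<le> p * real k * ln (real d)" "0 \<le> p * real d" using p ln0 by auto
  show "224 * p * real d \<le> e\<^sup>2" "48 * p * real k * ln (real d) \<le> e\<^sup>2"
    using main nonneg by auto
  have e0: "0 < e" using q k by (simp add: e_def)
  have "20 * e \<le> p * real k" using q k by (simp add: e_def mult_right_mono)
  then have "20 * e * ln (real d) \<le> p * real k * ln (real d)" using ln0 by (rule mult_right_mono)
  then have "e * (5000 * ln (real d)) \<le> e * e" using main nonneg by (simp add: power2_eq_square)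
  then have "5000 * ln (real d) \<le> e" using e0 by simp
  then show "84 * ln (real d) \<le> e" using ln0 by linarith
qed

theorem corollary4:
  shows "\<exists>c1 c2 c3 :: real. 0 < c1 \<and> 0 < c2 \<and> 0 < c3 \<and>
    (\<forall>(d::nat) (k::nat) (p::real) (q::real) (Fs::real vec).
       1 \<le> k \<and> Fs \<in> cluster_vectors d k \<and> 0 \<le> q \<and> q < p \<and> p \<le> 1 \<and>
       (p - q)\<^sup>2 / p \<ge> c1 * (ln (real d) / real k + real d / (real k)\<^sup>2) \<longrightarrow>
       measure_pmf.prob (planted_densest_subgraph d Fs p q)
         {A. let S = A - ((p + q) / 2) \<cdot>\<^sub>m ones_mat d;
                 \<eta> = (\<lambda>t::nat. c2 * (1 / ((p - q) * real k)))
             in \<forall>F0 \<in> feasible d k \<inter> sign_ball d (1/5 * sqrt (real k)) Fs.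
                  \<forall>t\<ge>1. (sign_dist (proj_grad_iter (feasible d k) \<eta> (loss S) F0 t) Fs)\<^sup>2
                       \<le> (1 - c3) ^ t * (sign_dist F0 Fs)\<^sup>2}
       \<ge> 1 - 1 / real d ^ 3)"
proof (rule exI[of _ 100000], rule exI[of _ 1], rule exI[of _ "3/10"], intro conjI allI impI)
  \<comment> \<open>The choice \<open>c2 = 1\<close> is the step size of the contraction lemma, and
    \<open>c3 = 3/10\<close> complements its factor 7/10.\<close>
  fix d k :: nat and p q :: real and Fs :: "real vec"
  let ?E = "{A. let S = A - ((p + q) / 2) \<cdot>\<^sub>m ones_mat d;
                 \<eta> = (\<lambda>t::nat. 1 * (1 / ((p - q) * real k)))
             in \<forall>F0 \<in> feasible d k \<inter> sign_ball d (1/5 * sqrt (real k)) Fs.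
                  \<forall>t\<ge>1. (sign_dist (proj_grad_iter (feasible d k) \<eta> (loss S) F0 t) Fs)\<^sup>2
                       \<le> (1 - 3/10) ^ t * (sign_dist F0 Fs)\<^sup>2}"
  assume "1 \<le> k \<and> Fs \<in> cluster_vectors d k \<and> 0 \<le> q \<and> q < p \<and> p \<le> 1 \<and>
       (p - q)\<^sup>2 / p \<ge> 100000 * (ln (real d) / real k + real d / (real k)\<^sup>2)"
  then have k: "1 \<le> k" and Fs: "Fs \<in> cluster_vectors d k" and q: "0 \<le> q" "q < p" and p: "p \<le> 1"
    and snr: "100000 * (ln (real d) / real k + real d / (real k)\<^sup>2) \<le> (p - q)\<^sup>2 / p"
    by auto
  define C where "C = {i. i < d \<and> Fs $ i = 1}"
  note C = cluster_support[OF Fs, folded C_def]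
  have "1 \<le> d" using C(2,4) k card_mono[of "{..<d}" C] by simp
  then consider "d = 1" | "2 \<le> d" by linarith
  then show "1 - 1 / real d ^ 3 \<le> measure_pmf.prob (planted_densest_subgraph d Fs p q) ?E"
  proof cases
    \<comment> \<open>The claimed lower bound is 0 here.\<close>
    case 1
    then show ?thesis by simp
  next
    case d: 2
    define r where "r = (\<lambda>(i, j). if Fs $ i = 1 \<and> Fs $ j = 1 then p else q)"
    interpret bernoulli_matrix d p r
      using q p by unfold_locales (auto simp: r_def)
    define \<delta> where "\<delta> = p - q"
    define e where "e = \<delta> * real k / 20"
    define A where "A X = mat d d (\<lambda>(i, j). of_bool (X (min i j, max i j)) :: real)" for X
    \<comment> \<open>The event does not mention the initial vector, so outside it all
      \<open>F0\<close> are handled at once, including one chosen after seeing the matrix.\<close>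
    define bad where "bad X \<longleftrightarrow> (\<exists>S\<in>Pow {..<d}. set_deviation e S X)
      \<or> (\<exists>i\<in>{..<d}. e < \<bar>\<Sum>j<d. noise X i j * Fs $ j\<bar>)" for X
    note snr' = planted_snr_bounds[OF d k q snr, folded \<delta>_def, folded e_def]
    have "(\<lambda>e. bernoulli_pmf (r e)) = (\<lambda>(i, j). bernoulli_pmf (if Fs $ i = 1 \<and> Fs $ j = 1 then p else q))"
      by (auto simp: r_def fun_eq_iff)
    then have model: "planted_densest_subgraph d Fs p q = map_pmf A law"
      unfolding planted_densest_subgraph_def law_def pairs_def A_def[abs_def] by simp
    have Fs_le_1: "\<bar>Fs $ j\<bar> \<le> 1" if "j < d" for j
      using C(5)[OF that] by (simp add: indicator_def)
    have sumFs: "(\<Sum>j<d. (Fs $ j)\<^sup>2) = real k"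
    proof -
      have "(\<Sum>j<d. (Fs $ j)\<^sup>2) = (\<Sum>j<d. Fs $ j)"
        using C(5) by (intro sum.cong) (auto simp: indicator_def)
      then show ?thesis using cluster_vector_feasible[OF Fs] by (simp add: feasible_def)
    qed
    have contraction: "1 - 3/10 = (7/10 :: real)" by simp
    have good: "A X \<in> ?E" if "\<not> bad X" for X
    proof -
      let ?S = "A X - ((p + q) / 2) \<cdot>\<^sub>m ones_mat d"
      have S: "?S \<in> carrier_mat d d" by (rule carrier_matI) (simp_all add: ones_mat_def)
      \<comment> \<open>The mean minus \<open>(p + q) / 2\<close> is \<open>\<delta> / 2\<close> on
        the cluster block and \<open>- \<delta> / 2\<close> elsewhere.\<close>
      have entry: "?S $$ (i, j) = noise X i j + \<delta> * (Fs $ i * Fs $ j) - \<delta> / 2" if "i < d" "j < d" for i j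
      proof -
        have "Fs $ i = 0 \<or> Fs $ i = 1" "Fs $ j = 0 \<or> Fs $ j = 1"
          using Fs that by (auto simp: cluster_vectors_def)
        moreover have "r (min i j, max i j) = (if Fs $ i = 1 \<and> Fs $ j = 1 then p else q)"
          by (auto simp: r_def min_def max_def)
        ultimately show ?thesis
          using that by (auto simp: A_def ones_mat_def noise_def \<delta>_def field_simps)
      qed
      have R: "(\<Sum>i<d. w i * (\<Sum>j\<in>T. noise X i j)) \<le> \<delta> * real k / 20 * (real (card T) + (\<Sum>i<d. (w i)\<^sup>2))"
        if "T \<subseteq> {..<d}" "\<And>i. i < d \<Longrightarrow> \<bar>w i\<bar> \<le> 1" for T w
        using \<open>\<not> bad X\<close> that unfolding bad_def set_deviation_def e_def not_less[symmetric] by blast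
      have R0: "\<bar>\<Sum>j<d. noise X i j * Fs $ j\<bar> \<le> \<delta> * real k / 20" if "i < d" for i
        using \<open>\<not> bad X\<close> that unfolding bad_def e_def by (auto simp: not_less)
      have "0 < \<delta>" using q by (simp add: \<delta>_def)
      note iter = projected_gradient_iterates[OF Fs k this S entry noise_sym R R0]
      show ?thesis
        unfolding Let_def mem_Collect_eq \<delta>_def[symmetric] mult_1 contraction
        by (intro ballI allI impI iter) (auto simp: sign_ball_def)
    qed
    have "measure_pmf.prob law {X. bad X}
        \<le> measure_pmf.prob law {X. \<exists>S\<in>Pow {..<d}. set_deviation e S X}
          + measure_pmf.prob law {X. \<exists>i\<in>{..<d}. e < \<bar>\<Sum>j<d. noise X i j * Fs $ j\<bar>}"
      unfolding bad_def Collect_disj_eq by (rule measure_Un_le) auto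
    also have "\<dots> \<le> 1 / (2 * real d ^ 3) + 1 / (2 * real d ^ 3)"
      using snr' Fs_le_1
      by (intro add_mono prob_some_set_deviation_le prob_row_deviation_le d) (simp_all add: sumFs)
    also have "\<dots> = 1 / real d ^ 3" by (simp add: field_simps)
    finally have "1 - 1 / real d ^ 3 \<le> 1 - measure_pmf.prob law {X. bad X}" by simp
    also have "\<dots> = measure_pmf.prob law {X. \<not> bad X}"
      using measure_pmf.prob_compl[of "{X. bad X}" law] by (simp add: Compl_eq_Diff_UNIV[symmetric] Collect_neg_eq)
    also have "\<dots> \<le> measure_pmf.prob law (A -` ?E)"
      using good by (intro measure_pmf.finite_measure_mono) auto
    also have "\<dots> = measure_pmf.prob (planted_densest_subgraph d Fs p q) ?E"
      unfolding model by (simp only: measure_map_pmf)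
    finally show ?thesis .
  qed
qed auto

end
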